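(* Let $k\geq 1$ and let $M$ be a set of $n\geq 2$ positive integers. There is a bijection $\chi:\widetilde{\mathcal{Q}}_M(k)\to\mathcal{T}_M(k)$ such that $\mathrm{ap}(\pi)=\mathrm{lleaf}(\chi(\pi))$ for every $\pi\in\widetilde{\mathcal{Q}}_M(k)$. Moreover, for every $\pi=\pi_1\pi_2\cdots\in\widetilde{\mathcal{Q}}_M(k)$, one has $\pi_1=\pi_2=\cdots=\pi_k$ if and only if the first $k-1$ children (from the left) of the root of $\chi(\pi)$ are leaves.
   Context: For $M=\{a_1<\dots<a_n\}$, $M_k$ denotes the multiset $\{a_1^k,\dots,a_n^k\}$. A Stirling permutation of a multiset is a word $\pi=\pi_1\pi_2\cdots$ using exactly the multiset's elements such that $\pi_i=\pi_l$ with $i<l$ implies $\pi_j\geq\pi_i$ for all $i<j<l$. $\widetilde{\mathcal{Q}}_M(k)$ is the set of Stirling permutations of $M_k$ whose first letter is $\min M$. For $\pi=\pi_1\cdots\pi_{kn}$, an index $i$ is a longest ascent-plateau if $\pi_i<\pi_{i+1}=\cdots=\pi_{i+k}$; $\mathrm{ap}(\pi)$ is the number of longest ascent-plateaux of $\pi$. Trees: all trees are ordered (plane) rooted trees; the level of a node is its distance from the root (root at level 0); a leaf is a node with no children. An even $k$-ary tree is an ordered tree in which every node on an even level has exactly $k$ children. A pruned even $k$-ary tree is obtained from an even $k$-ary tree by deleting, for every even-level node all of whose children are leaves, all those children. An increasing pruned even $k$-ary tree on $M$ is a pruned even $k$-ary tree whose nodes on even levels are labeled bijectively by $M$ (odd-level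 nodes are unlabeled) such that labels increase along every path from the root downward and, for each node, the labels of its children increase from left to right. $\mathcal{T}_M(k)$ is the set of such trees. A labeled leaf is a leaf on an even level; $\mathrm{lleaf}(T)$ is the number of labeled leaves of $T$. *)

theory Defs
  imports Main "HOL-Library.Multiset"
begin

text \<open>Words are lists of natural numbers, so positions count from 0.\<close>

definition multiset_pow :: "nat set \<Rightarrow> nat \<Rightarrow> nat multiset" where
  "multiset_pow M k = repeat_mset k (mset_set M)"

definition stirling_permutation_of :: "nat multiset \<Rightarrow> nat list \<Rightarrow> bool" where
  "stirling_permutation_of A \<pi> \<longleftrightarrow>
     mset \<pi> = A \<and>
     (\<forall>i j l. i < j \<and> j < l \<and> l < length \<pi> \<and> \<pi> ! i = \<pi> ! l \<longrightarrow> \<pi> ! i \<le> \<pi> ! j)"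

definition Qtilde :: "nat set \<Rightarrow> nat \<Rightarrow> nat list set" where
  "Qtilde M k =
     {\<pi>. stirling_permutation_of (multiset_pow M k) \<pi> \<and> \<pi> \<noteq> [] \<and> hd \<pi> = Min M}"

definition longest_ascent_plateau :: "nat \<Rightarrow> nat list \<Rightarrow> nat \<Rightarrow> bool" where
  "longest_ascent_plateau k \<pi> i \<longleftrightarrow>
     i + k < length \<pi> \<and> \<pi> ! i < \<pi> ! (i + 1) \<and> (\<forall>j\<in>{1..k}. \<pi> ! (i + j) = \<pi> ! (i + 1))"

definition ap :: "nat \<Rightarrow> nat list \<Rightarrow> nat" where
  "ap k \<pi> = card {i. longest_ascent_plateau k \<pi> i}"

text \<open>
  Ordered rooted trees. A node is addressed by the list of child indices (from 0, left to right)
  leading to it from the root, so that its level is the length of its address. In \<open>subtree_at\<close>,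
  only addresses satisfying \<open>is_node\<close> are meaningful.
\<close>

datatype 'a ptree = Node (label: 'a) (children: "'a ptree list")

fun is_node :: "'a ptree \<Rightarrow> nat list \<Rightarrow> bool" where
  "is_node t [] \<longleftrightarrow> True"
| "is_node t (i # p) \<longleftrightarrow> i < length (children t) \<and> is_node (children t ! i) p"

fun subtree_at :: "'a ptree \<Rightarrow> nat list \<Rightarrow> 'a ptree" where
  "subtree_at t [] = t"
| "subtree_at t (i # p) = subtree_at (children t ! i) p"

definition nodes :: "'a ptree \<Rightarrow> nat list set" where
  "nodes t = {p. is_node t p}"

definition even_nodes :: "'a ptree \<Rightarrow> nat list set" where
  "even_nodes t = {p \<in> nodes t. even (length p)}"

definition label_at :: "'a ptree \<Rightarrow> nat list \<Rightarrow> 'a" where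
  "label_at t p = label (subtree_at t p)"

definition is_leaf :: "'a ptree \<Rightarrow> bool" where
  "is_leaf t \<longleftrightarrow> children t = []"

definition even_kary :: "nat \<Rightarrow> 'a ptree \<Rightarrow> bool" where
  "even_kary k t \<longleftrightarrow> (\<forall>p \<in> even_nodes t. length (children (subtree_at t p)) = k)"

text \<open>The Boolean argument records whether the root of the given subtree is on an even level.\<close>

fun prune_from :: "bool \<Rightarrow> 'a ptree \<Rightarrow> 'a ptree" where
  "prune_from ev (Node x ts) =
     Node x (if ev \<and> (\<forall>t \<in> set ts. is_leaf t) then [] else map (prune_from (\<not> ev)) ts)"

definition prune :: "'a ptree \<Rightarrow> 'a ptree" where
  "prune t = prune_from True t"

definition pruned_even_kary :: "nat \<Rightarrow> 'a ptree \<Rightarrow> bool" where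
  "pruned_even_kary k t \<longleftrightarrow> (\<exists>s. even_kary k s \<and> t = prune s)"

text \<open>
  Labels have type \<open>nat option\<close>, where \<open>None\<close> marks an unlabeled node. The underlying unlabeled
  tree is obtained by replacing all labels by the unit element. In the last condition below, the
  nodes \<open>p @ [i]\<close> and \<open>p @ [j]\<close> are the children of the odd-level node \<open>p\<close>; children of even-level
  nodes carry no labels.
\<close>

definition shape :: "'a ptree \<Rightarrow> unit ptree" where
  "shape t = map_ptree (\<lambda>_. ()) t"

definition increasing_pruned_trees :: "nat set \<Rightarrow> nat \<Rightarrow> nat option ptree set" where
  "increasing_pruned_trees M k =
     {T. pruned_even_kary k (shape T)
       \<and> bij_betw (label_at T) (even_nodes T) (Some ` M)
       \<and> (\<forall>p \<in> nodes T. odd (length p) \<longrightarrow> label_at T p = None)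
       \<and> (\<forall>p q. p \<in> even_nodes T \<and> p @ q \<in> even_nodes T \<and> q \<noteq> [] \<longrightarrow>
             the (label_at T p) < the (label_at T (p @ q)))
       \<and> (\<forall>p i j. p @ [i] \<in> even_nodes T \<and> p @ [j] \<in> even_nodes T \<and> i < j \<longrightarrow>
             the (label_at T (p @ [i])) < the (label_at T (p @ [j])))}"

definition lleaf :: "'a ptree \<Rightarrow> nat" where
  "lleaf T = card {p \<in> even_nodes T. is_leaf (subtree_at T p)}"

end

theory Submission
  imports Defs
begin

text \<open>
  Read a word off a tree as follows: an odd-level node contributes the words of its children in
  order, and a node labeled \<open>a\<close> whose \<open>k\<close> children have words \<open>W\<^sub>1, \<dots>, W\<^sub>k\<close> contributes
  \<open>W\<^sub>1 a W\<^sub>2 a \<dots> W\<^sub>k a\<close>, where the children deleted by pruning count as empty words. Splitting a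
  Stirling permutation at the occurrences of its minimum inverts this: by the Stirling condition
  all copies of any other letter lie in the same segment, so each segment is again a Stirling
  permutation with every multiplicity \<open>k\<close>. The last segment, after the final copy of the minimum,
  encodes the siblings to the right. The word of a whole tree ends with the minimum, and moving
  that last letter to the front gives a word with first letter \<open>min M\<close>.

  The word of a node \<open>a\<close> other than the root is always preceded by a smaller letter: the parent
  label or the label of the sibling to the left. Hence the copies of \<open>a\<close> form a longest
  ascent-plateau exactly if all segments \<open>W\<^sub>i\<close> are empty, that is, if \<open>a\<close> labels a leaf.
\<close>

subsection \<open>Stirling words\<close>

text \<open>The order condition of \<open>stirling_permutation_of\<close> without a prescribed
  multiset, so that it can be passed to segments of a word.\<close>

definition stirling :: "nat list \<Rightarrow> bool" where
  "stirling w \<longleftrightarrow> (\<forall>i j l. i < j \<and> j < l \<and> l < length w \<and> w ! i = w ! l \<longrightarrow> w ! i \<le> w ! j)"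

lemma stirlingD:
  "stirling w \<Longrightarrow> i < j \<Longrightarrow> j < l \<Longrightarrow> l < length w \<Longrightarrow> w ! i = w ! l \<Longrightarrow> w ! i \<le> w ! j"
  unfolding stirling_def by blast

lemma stirling_Nil [simp]: "stirling []"
  by (simp add: stirling_def)

lemma stirling_single [simp]: "stirling [a]"
  by (simp add: stirling_def)

lemma stirling_replicate [simp]: "stirling (replicate n a)"
  by (simp add: stirling_def)

lemma stirling_appendD1:
  assumes "stirling (u @ v)" shows "stirling u"
  unfolding stirling_def
proof (intro allI impI, elim conjE)
  fix i j l assume "i < j" "j < l" "l < length u" "u ! i = u ! l"
  then show "u ! i \<le> u ! j"
    using stirlingD[OF assms, of i j l] by (simp add: nth_append)
qed

lemma stirling_appendD2:
  assumes "stirling (u @ v)" shows "stirling v"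
  unfolding stirling_def
proof (intro allI impI, elim conjE)
  fix i j l assume "i < j" "j < l" "l < length v" "v ! i = v ! l"
  then show "v ! i \<le> v ! j"
    using stirlingD[OF assms, of "length u + i" "length u + j" "length u + l"]
    by (simp add: nth_append)
qed

text \<open>Two copies of \<open>a\<close> enclose \<open>m\<close>. For the least letter
  \<open>m\<close> this forces all copies of any other letter into one segment between copies of
  \<open>m\<close>.\<close>

lemma stirling_between:
  assumes "stirling (u @ m # v)" "a \<in> set u" "a \<in> set v"
  shows "a \<le> m"
proof -
  obtain i where i: "i < length u" "u ! i = a" using assms(2) by (auto simp: in_set_conv_nth)
  obtain l where l: "l < length v" "v ! l = a" using assms(3) by (auto simp: in_set_conv_nth)
  show ?thesis
    using stirlingD[OF assms(1), of i "length u" "Suc (length u + l)"] i l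
    by (simp add: nth_append)
qed

text \<open>A pair of equal letters lies in one factor or has one letter in each;
  \<open>common\<close> handles the latter. It holds for disjoint factors, and for factors whose
  only shared letter is the minimum.\<close>

lemma stirling_append:
  assumes "stirling u" "stirling v"
    and common: "\<And>a b. a \<in> set u \<Longrightarrow> a \<in> set v \<Longrightarrow> b \<in> set u \<union> set v \<Longrightarrow> a \<le> b"
  shows "stirling (u @ v)"
  unfolding stirling_def
proof (intro allI impI, elim conjE)
  fix i j l assume ijl: "i < j" "j < l" "l < length (u @ v)" "(u @ v) ! i = (u @ v) ! l"
  consider "l < length u" | "length u \<le> i" | "i < length u" "length u \<le> l" by linarith
  then show "(u @ v) ! i \<le> (u @ v) ! j"
  proof cases
    case 1
    then show ?thesis using ijl stirlingD[OF assms(1), of i j l] by (simp add: nth_append)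
  next
    case 2
    then show ?thesis
      using ijl stirlingD[OF assms(2), of "i - length u" "j - length u" "l - length u"]
      by (simp add: nth_append)
  next
    case 3
    have "(u @ v) ! i \<in> set u" using 3 by (simp add: nth_append)
    moreover have "(u @ v) ! l \<in> set v" using 3 ijl by (simp add: nth_append)
    moreover have "(u @ v) ! j \<in> set u \<union> set v" using ijl nth_mem[of j "u @ v"] by simp
    ultimately show ?thesis using common ijl(4) by metis
  qed
qed

text \<open>A minimal letter at either end adds no constraint, because whatever a pair of its copies
  encloses is at least as large. Both sides thus amount to \<open>stirling v\<close>.\<close>

lemma stirling_rotate_min:
  assumes "\<And>b. b \<in> set v \<Longrightarrow> m \<le> b"
  shows "stirling (m # v) \<longleftrightarrow> stirling (v @ [m])"
proof -
  have "stirling (m # v) \<longleftrightarrow> stirling v"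
    using stirling_append[of "[m]" v] stirling_appendD2[of "[m]" v] assms by auto
  moreover have "stirling (v @ [m]) \<longleftrightarrow> stirling v"
    using stirling_append[of v "[m]"] stirling_appendD1[of v "[m]"] assms by auto
  ultimately show ?thesis by simp
qed

section \<open>Cutting a word at the copies of a letter\<close>

abbreviation terminate_by :: "'a \<Rightarrow> 'a list list \<Rightarrow> 'a list" where
  "terminate_by m Ws \<equiv> concat (map (\<lambda>W. W @ [m]) Ws)"

text \<open>Each copy of \<open>m\<close> closes a block, possibly an empty one, and
  \<open>R\<close> is what follows the last copy. In the induction, another letter joins the first
  block, or \<open>R\<close> if there is no block.\<close>

lemma split_at_letter:
  "\<exists>Ws R. w = terminate_by m Ws @ R \<and> m \<notin> set R \<and> (\<forall>W\<in>set Ws. m \<notin> set W)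
     \<and> length Ws = count (mset w) m"
proof (induction w)
  case Nil
  then show ?case by (intro exI[of _ "[]"]) simp
next
  case (Cons x w)
  then obtain Ws R where *: "w = terminate_by m Ws @ R" "m \<notin> set R" "\<forall>W\<in>set Ws. m \<notin> set W"
    "length Ws = count (mset w) m" by blast
  show ?case
  proof (cases "x = m")
    case True
    with * show ?thesis by (intro exI[of _ "[] # Ws"] exI[of _ R]) simp
  next
    case False
    show ?thesis
    proof (cases Ws)
      case Nil
      with * False show ?thesis by (intro exI[of _ "[]"] exI[of _ "x # R"]) simp
    next
      case (Cons W Vs)
      with * False show ?thesis by (intro exI[of _ "(x # W) # Vs"] exI[of _ R]) simp
    qed
  qed
qed

text \<open>The first block is the longest prefix free of \<open>m\<close>, so the decompositions
  agree block by block.\<close>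

lemma split_at_letter_unique:
  assumes "terminate_by m Ws @ R = terminate_by m Ws' @ R'"
    and "m \<notin> set R" "m \<notin> set R'" "\<forall>W\<in>set Ws. m \<notin> set W" "\<forall>W\<in>set Ws'. m \<notin> set W"
  shows "Ws = Ws' \<and> R = R'"
  using assms
proof (induction Ws arbitrary: Ws')
  case Nil
  then show ?case by (cases Ws') auto
next
  case (Cons W Ws)
  show ?case
  proof (cases Ws')
    case Nil
    then show ?thesis using Cons.prems by auto
  next
    case (Cons W' Vs)
    have "W @ m # (terminate_by m Ws @ R) = W' @ m # (terminate_by m Vs @ R')"
      using Cons.prems(1) Cons by simp
    moreover have "takeWhile (\<lambda>x. x \<noteq> m) (V @ m # z) = V" if "m \<notin> set V" for V z
      using that by (induction V) auto
    then have "takeWhile (\<lambda>x. x \<noteq> m) (W @ m # (terminate_by m Ws @ R)) = W"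
      "takeWhile (\<lambda>x. x \<noteq> m) (W' @ m # (terminate_by m Vs @ R')) = W'"
      using Cons.prems(4,5) Cons by auto
    ultimately have "W = W'" "terminate_by m Ws @ R = terminate_by m Vs @ R'" by auto
    then show ?thesis using Cons.IH[of Vs] Cons.prems Cons by auto
  qed
qed

text \<open>By \<open>stirling_between\<close>, no letter of a segment recurs beyond the next
  \<open>m\<close>. All its copies lie in that segment, which therefore keeps the full
  multiplicity.\<close>

lemma stirling_segments:
  assumes "stirling (terminate_by m Ws @ R)" "W \<in> set (Ws @ [R])" "\<forall>V\<in>set (Ws @ [R]). \<forall>b\<in>set V. m < b"
  shows "stirling W \<and> (\<forall>a\<in>set W. count (mset W) a = count (mset (terminate_by m Ws @ R)) a)"
  using assms
proof (induction Ws)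
  case Nil
  then show ?case by simp
next
  case (Cons V Ws)
  let ?w = "terminate_by m Ws @ R"
  have st: "stirling (V @ m # ?w)" using Cons.prems(1) by simp
  have disj: "a \<notin> set ?w" if "a \<in> set V" for a
    using stirling_between[OF st that] Cons.prems(3) that by force
  have cnt: "count (mset (V @ m # ?w)) a = count (mset V) a + count (mset [m]) a + count (mset ?w) a" for a
    by simp
  show ?case
  proof (cases "W = V")
    case True
    have "count (mset (V @ m # ?w)) a = count (mset V) a" if "a \<in> set V" for a
    proof -
      have "m \<noteq> a" using Cons.prems(3) that by force
      moreover have "count (mset ?w) a = 0" using disj[OF that] by (metis count_mset_0_iff)
      ultimately show ?thesis using cnt[of a] by simp
    qed
    then show ?thesis using stirling_appendD1[OF st] True by simp
  next
    case False
    then have W: "W \<in> set (Ws @ [R])" using Cons.prems(2) by auto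
    have "stirling ?w" using stirling_appendD2[of "V @ [m]" ?w] st by simp
    then have IH: "stirling W" "\<And>a. a \<in> set W \<Longrightarrow> count (mset W) a = count (mset ?w) a"
      using Cons.IH W Cons.prems(3) by auto
    have "count (mset (V @ m # ?w)) a = count (mset ?w) a" if "a \<in> set W" for a
    proof -
      have "m \<noteq> a" using Cons.prems(3) W that by force
      moreover have "a \<in> set ?w" using W that by auto
      then have "count (mset V) a = 0" using disj by (metis count_mset_0_iff)
      ultimately show ?thesis using cnt[of a] by simp
    qed
    then show ?thesis using IH by simp
  qed
qed

subsection \<open>The word of a tree\<close>

text \<open>In a valid tree the label distinguishes the levels: it is \<open>None\<close> exactly on odd ones.\<close>

fun tree_word :: "nat \<Rightarrow> nat option ptree \<Rightarrow> nat list" where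
  "tree_word k (Node None ts) = concat (map (tree_word k) ts)"
| "tree_word k (Node (Some a) ts) =
     (if ts = [] then replicate k a else concat (map (\<lambda>t. tree_word k t @ [a]) ts))"

text \<open>The labels in preorder. A list is used so that \<open>distinct\<close> can express
  injectivity of the labeling.\<close>

fun labels :: "nat option ptree \<Rightarrow> nat list" where
  "labels (Node x ts) = (case x of None \<Rightarrow> [] | Some a \<Rightarrow> [a]) @ concat (map labels ts)"

text \<open>All shape, level and order conditions in recursive form, also for subtrees with an
  unlabeled root. Comparing \<open>a\<close> with every label below it replaces the condition on
  paths. Distinctness of labels is kept separate.\<close>

fun valid :: "nat \<Rightarrow> nat option ptree \<Rightarrow> bool" where
  "valid k (Node None ts) \<longleftrightarrow>
     sorted_wrt (<) (map (the \<circ> label) ts) \<and> (\<forall>t\<in>set ts. label t \<noteq> None \<and> valid k t)"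
| "valid k (Node (Some a) ts) \<longleftrightarrow>
     (ts = [] \<or> length ts = k \<and> (\<exists>t\<in>set ts. \<not> is_leaf t)) \<and>
     (\<forall>t\<in>set ts. label t = None \<and> valid k t \<and> (\<forall>b\<in>set (labels t). a < b))"

section \<open>Letters of tree words\<close>

lemma count_concat: "count (mset (concat xss)) a = (\<Sum>xs\<leftarrow>xss. count (mset xs) a)"
  by (induction xss) auto

text \<open>A labeled node writes its label once after each of its \<open>k\<close> children, or
  \<open>k\<close> times outright if they were pruned; an unlabeled node writes no letter of its
  own.\<close>

lemma count_tree_word:
  "valid k t \<Longrightarrow> count (mset (tree_word k t)) b = k * count (mset (labels t)) b"
proof (induction k t rule: tree_word.induct)
  case (1 k ts)
  have "(\<Sum>t\<leftarrow>ts. count (mset (tree_word k t)) b) = (\<Sum>t\<leftarrow>ts. k * count (mset (labels t)) b)"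
    using 1 by (intro arg_cong[of _ _ sum_list] map_cong) auto
  then show ?case by (simp add: count_concat comp_def sum_list_const_mult)
next
  case (2 k a ts)
  show ?case
  proof (cases "ts = []")
    case True
    then show ?thesis by simp
  next
    case False
    have *: "(\<Sum>t\<leftarrow>ts. count (mset (tree_word k t)) b) = (\<Sum>t\<leftarrow>ts. k * count (mset (labels t)) b)"
      using 2 False by (intro arg_cong[of _ _ sum_list] map_cong) auto
    have "length ts = k" using 2 False by simp
    then have "count (mset (tree_word k (Node (Some a) ts))) b =
        (\<Sum>t\<leftarrow>ts. count (mset (tree_word k t)) b) + k * count (mset [a]) b"
      using False by (simp add: count_concat comp_def sum_list_Suc)
    also have "\<dots> = k * count (mset (labels (Node (Some a) ts))) b"
      unfolding * by (simp add: count_concat comp_def sum_list_const_mult distrib_left)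
    finally show ?thesis .
  qed
qed

lemma set_tree_word:
  assumes "valid k t" "k \<ge> 1"
  shows "set (tree_word k t) = set (labels t)"
proof -
  have "b \<in> set (tree_word k t) \<longleftrightarrow> b \<in> set (labels t)" for b
    using count_tree_word[OF assms(1), of b] assms(2) count_mset_0_iff[of "tree_word k t" b]
      count_mset_0_iff[of "labels t" b] by auto
  then show ?thesis by blast
qed

text \<open>Restores pruned children as unlabeled leaves, whose words are empty, so that one formula
  covers both branches of \<open>tree_word\<close> at a labeled node.\<close>

definition unpruned :: "nat \<Rightarrow> nat option ptree list \<Rightarrow> nat option ptree list" where
  "unpruned k ts = (if ts = [] then replicate k (Node None []) else ts)"

lemma tree_word_unpruned:
  "tree_word k (Node (Some a) ts) = terminate_by a (map (tree_word k) (unpruned k ts))"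
proof -
  have "concat (replicate n [a]) = replicate n a" for n by (induction n) auto
  then show ?thesis by (simp add: unpruned_def comp_def map_replicate_const)
qed

lemma valid_unpruned:
  assumes "valid k (Node (Some a) ts)"
  shows "length (unpruned k ts) = k"
    and "\<And>t. t \<in> set (unpruned k ts) \<Longrightarrow> label t = None \<and> valid k t \<and> (\<forall>b\<in>set (labels t). a < b)"
  using assms by (auto simp: unpruned_def split: if_splits)

text \<open>Restored children are all leaves, whereas a nonempty child list of a valid labeled node
  contains a nonleaf, so the two cases cannot collide.\<close>

lemma unpruned_inj:
  assumes "valid k (Node (Some a) ts)" "valid k (Node (Some b) us)" "unpruned k ts = unpruned k us"
  shows "ts = us"
proof -
  have "replicate k (Node None []) \<noteq> us" if "\<exists>t\<in>set us. \<not> is_leaf t" for us :: "nat option ptree list"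
    using that by (auto simp: is_leaf_def)
  from this[of ts] this[of us] show ?thesis
    using assms by (cases "ts = []"; cases "us = []") (auto simp: unpruned_def)
qed

lemma labels_ge_root:
  "valid k (Node (Some a) ts) \<Longrightarrow> b \<in> set (labels (Node (Some a) ts)) \<Longrightarrow> a \<le> b"
  by fastforce

text \<open>The siblings to the right have larger root labels, and each root label is the least in
  its own tree. Hence the first root label is the letter at which the word of a forest has to be
  cut.\<close>

lemma valid_forest_Cons:
  assumes "valid k (Node None (t # ts))"
  obtains m us where "t = Node (Some m) us" "valid k (Node (Some m) us)" "valid k (Node None ts)"
    "\<And>b. b \<in> set (labels (Node None ts)) \<Longrightarrow> m < b"
proof -
  obtain m us where t: "t = Node (Some m) us" using assms by (cases t) auto
  have "m < b" if b: "b \<in> set (labels (Node None ts))" for b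
  proof -
    obtain s where s: "s \<in> set ts" "b \<in> set (labels s)" using b by auto
    have vs: "valid k s" "label s \<noteq> None" using assms s by auto
    then obtain c vs where c: "s = Node (Some c) vs" by (cases s) auto
    then have "c \<le> b" using vs labels_ge_root s c by blast
    moreover have "m < c" using assms s c t by auto
    ultimately show ?thesis by simp
  qed
  then show ?thesis using that t assms by simp
qed

text \<open>The child of an unlabeled nonleaf carries a label, which occurs in the word since
  \<open>k \<ge> 1\<close>.\<close>

lemma tree_word_Nil_iff:
  assumes "valid k t" "label t = None" "k \<ge> 1"
  shows "tree_word k t = [] \<longleftrightarrow> is_leaf t"
proof (cases t)
  case (Node x ts)
  show ?thesis
  proof (cases ts)
    case Nil
    then show ?thesis using Node assms by (simp add: is_leaf_def)
  next
    case (Cons s ss)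
    have "x = None" using Node assms by simp
    then obtain m us where "s = Node (Some m) us"
      using valid_forest_Cons[of k s ss] assms Node Cons by metis
    then have "labels t \<noteq> []" using Node Cons by simp
    then have "tree_word k t \<noteq> []" using set_tree_word[OF assms(1,3)] by fastforce
    then show ?thesis using Cons Node by (simp add: is_leaf_def)
  qed
qed

section \<open>Decoding words into trees\<close>

text \<open>Induction on the length of the word. Cutting at its least letter, the label of the first
  child, yields the words of the \<open>k\<close> subtrees below that child and of the forest of its
  right siblings, all of them shorter.\<close>

lemma tree_word_inj:
  assumes "k \<ge> 1" "valid k t" "valid k t'" "label t = None" "label t' = None"
    and "tree_word k t = tree_word k t'"
  shows "t = t'"
  using assms(2-)
proof (induction "length (tree_word k t)" arbitrary: t t' rule: less_induct)
  case less
  obtain ts where t: "t = Node None ts" using less.prems by (cases t) auto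
  obtain ts' where t': "t' = Node None ts'" using less.prems by (cases t') auto
  have leaf: "is_leaf t = is_leaf t'"
    using less.prems tree_word_Nil_iff assms(1) by metis
  show ?case
  proof (cases ts)
    case Nil
    then show ?thesis using leaf t t' by (simp add: is_leaf_def)
  next
    case (Cons s ss)
    with leaf t t' obtain s' ss' where ts': "ts' = s' # ss'" by (cases ts') (auto simp: is_leaf_def)
    obtain m us where m: "s = Node (Some m) us" "valid k (Node (Some m) us)" "valid k (Node None ss)"
      "\<And>b. b \<in> set (labels (Node None ss)) \<Longrightarrow> m < b"
      using valid_forest_Cons less.prems t Cons by metis
    obtain m' us' where m': "s' = Node (Some m') us'" "valid k (Node (Some m') us')"
      "valid k (Node None ss')" "\<And>b. b \<in> set (labels (Node None ss')) \<Longrightarrow> m' < b"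
      using valid_forest_Cons less.prems t' ts' by metis
    have setw: "set (labels t) = set (labels t')"
      using set_tree_word less.prems assms(1) by metis
    \<comment> \<open>Both root labels are the minimum of the same set of letters.\<close>
    have "m \<in> set (labels t)" "m' \<in> set (labels t')" using t t' m(1) m'(1) Cons ts' by auto
    moreover have "m \<le> b" if "b \<in> set (labels t)" for b
      using that labels_ge_root[OF m(2)] m(4) t m(1) Cons by fastforce
    moreover have "m' \<le> b" if "b \<in> set (labels t')" for b
      using that labels_ge_root[OF m'(2)] m'(4) t' m'(1) ts' by fastforce
    ultimately have mm: "m' = m" using setw by (metis antisym)
    note K = valid_unpruned[OF m(2)] and K' = valid_unpruned[OF m'(2)[unfolded mm]]
    have w: "tree_word k t = terminate_by m (map (tree_word k) (unpruned k us)) @ tree_word k (Node None ss)"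
      using t Cons m(1) by (simp add: tree_word_unpruned del: tree_word.simps(2))
    have w': "tree_word k t' = terminate_by m (map (tree_word k) (unpruned k us')) @ tree_word k (Node None ss')"
      using t' ts' m'(1) mm by (simp add: tree_word_unpruned del: tree_word.simps(2))
    have free: "m \<notin> set (tree_word k v)" if "v \<in> set (unpruned k us) \<union> set (unpruned k us')" for v
      using that K(2) K'(2) set_tree_word[of k v] assms(1) by auto
    have "m \<notin> set (tree_word k (Node None ss))"
      using m(3,4) set_tree_word[OF m(3) assms(1)] by blast
    moreover have "m \<notin> set (tree_word k (Node None ss'))"
      using m'(3,4) mm set_tree_word[OF m'(3) assms(1)] by blast
    ultimately have eq: "map (tree_word k) (unpruned k us) = map (tree_word k) (unpruned k us')"
        "tree_word k (Node None ss) = tree_word k (Node None ss')"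
      using split_at_letter_unique[of m "map (tree_word k) (unpruned k us)" "tree_word k (Node None ss)"
          "map (tree_word k) (unpruned k us')" "tree_word k (Node None ss')"]
        less.prems(5) w w' free by auto
    have shorter: "length (tree_word k v) < length (tree_word k t)" if v: "v \<in> set (unpruned k us)" for v
    proof -
      obtain xs ys where "unpruned k us = xs @ v # ys" using split_list v by fast
      then show ?thesis unfolding w by simp
    qed
    have "unpruned k us \<noteq> []" using K(1) assms(1) by auto
    then have "length (tree_word k (Node None ss)) < length (tree_word k t)"
      unfolding w by (cases "unpruned k us") auto
    then have "Node None ss = Node None ss'"
      using less.hyps[of "Node None ss" "Node None ss'"] m(3) m'(3) eq(2) by simp
    moreover have "unpruned k us = unpruned k us'"
    proof (rule nth_equalityI)
      show len: "length (unpruned k us) = length (unpruned k us')" using eq(1) map_eq_imp_length_eq by blast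
      fix i assume i: "i < length (unpruned k us)"
      have "tree_word k (unpruned k us ! i) = tree_word k (unpruned k us' ! i)"
        using eq(1) i len by (metis nth_map)
      then show "unpruned k us ! i = unpruned k us' ! i"
        using less.hyps[of "unpruned k us ! i" "unpruned k us' ! i"] shorter[OF nth_mem[OF i]]
          K(2)[OF nth_mem[OF i]] K'(2)[OF nth_mem[OF i[unfolded len]]] by simp
    qed
    then have "us = us'" using unpruned_inj m(2) m'(2) by blast
    ultimately show ?thesis using t t' Cons ts' m(1) m'(1) mm by simp
  qed
qed

text \<open>Induction on the length. Every segment cut out by the least letter \<open>m\<close> is
  again a Stirling word with all multiplicities \<open>k\<close>, so it is the word of an unlabeled
  node. The blocks become the children of a node labeled \<open>m\<close>, and the forest encoding
  \<open>R\<close> becomes its right siblings.\<close>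

lemma tree_word_surj:
  assumes "k \<ge> 1" "stirling w" "\<forall>a\<in>set w. count (mset w) a = k"
  shows "\<exists>t. label t = None \<and> valid k t \<and> tree_word k t = w"
  using assms(2-)
proof (induction "length w" arbitrary: w rule: less_induct)
  case less
  show ?case
  proof (cases "w = []")
    case True
    then show ?thesis by (intro exI[of _ "Node None []"]) simp
  next
    case False
    define m where "m = Min (set w)"
    have m: "m \<in> set w" "\<And>b. b \<in> set w \<Longrightarrow> m \<le> b" using False by (auto simp: m_def)
    obtain Ws R where w: "w = terminate_by m Ws @ R" "m \<notin> set R" "\<forall>W\<in>set Ws. m \<notin> set W"
      "length Ws = count (mset w) m" using split_at_letter[of w m] by blast
    have len: "length Ws = k" using w(4) less.prems m(1) by simp
    have gt: "\<forall>V\<in>set (Ws @ [R]). \<forall>b\<in>set V. m < b"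
    proof (intro ballI)
      fix V b assume V: "V \<in> set (Ws @ [R])" "b \<in> set V"
      then have "b \<in> set w" using w(1) by auto
      moreover have "b \<noteq> m" using V w(2,3) by auto
      ultimately show "m < b" using m(2) by (simp add: order.not_eq_order_implies_strict)
    qed
    have "\<exists>t. label t = None \<and> valid k t \<and> tree_word k t = V" if V: "V \<in> set (Ws @ [R])" for V
    proof -
      have "length V < length w"
      proof (cases "V \<in> set Ws")
        case True
        then obtain xs ys where "Ws = xs @ V # ys" using split_list by fast
        then show ?thesis unfolding w by simp
      next
        case False
        then have "V = R" using V by simp
        moreover have "Ws \<noteq> []" using len assms(1) by auto
        ultimately show ?thesis unfolding w by (cases Ws) auto
      qed
      moreover have seg: "stirling V" "\<forall>a\<in>set V. count (mset V) a = count (mset w) a"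
        using stirling_segments[of m Ws R V] less.prems(1) V gt w(1) by auto
      moreover have "set V \<subseteq> set w" using V w(1) by auto
      ultimately show ?thesis using less.hyps[of V] less.prems(2) by (metis subsetD)
    qed
    then obtain f where f: "\<And>V. V \<in> set (Ws @ [R]) \<Longrightarrow> label (f V) = None \<and> valid k (f V) \<and> tree_word k (f V) = V"
      by metis
    obtain rs where rs: "f R = Node None rs" using f[of R] by (cases "f R") auto
    \<comment> \<open>If all blocks are empty, all \<open>k\<close> children would be leaves, which
      is the situation that pruning removes.\<close>
    define us where "us = (if \<forall>W\<in>set Ws. W = [] then [] else map f Ws)"
    have leaf: "is_leaf (f V) \<longleftrightarrow> V = []" if "V \<in> set Ws" for V
      using tree_word_Nil_iff[of k "f V"] f[of V] assms(1) that by auto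
    have lab: "set (labels (f V)) = set V" if "V \<in> set (Ws @ [R])" for V
      using set_tree_word f that assms(1) by metis
    have word: "tree_word k (Node (Some m) us) = terminate_by m Ws"
    proof (cases "\<forall>W\<in>set Ws. W = []")
      case True
      then have "Ws = replicate k []" using len by (simp add: replicate_eqI)
      moreover have "concat (replicate n [m]) = replicate n m" for n by (induction n) auto
      ultimately show ?thesis using True by (simp add: us_def)
    next
      case False
      have "map (\<lambda>t. tree_word k t @ [m]) (map f Ws) = map (\<lambda>W. W @ [m]) Ws" using f by simp
      moreover have "us = map f Ws" "us \<noteq> []" using False by (auto simp: us_def)
      ultimately show ?thesis by (metis tree_word.simps(2))
    qed
    have val: "valid k (Node (Some m) us)"
    proof (cases "\<forall>W\<in>set Ws. W = []")
      case True
      then show ?thesis by (simp add: us_def)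
    next
      case False
      then have us: "us = map f Ws" by (auto simp: us_def)
      have "\<exists>t\<in>set us. \<not> is_leaf t" using False leaf us by auto
      moreover have "label t = None \<and> valid k t \<and> (\<forall>b\<in>set (labels t). m < b)" if t: "t \<in> set us" for t
      proof -
        obtain V where "V \<in> set Ws" "t = f V" using t us by auto
        then show ?thesis using f[of V] lab[of V] gt by simp
      qed
      ultimately show ?thesis using us len by simp
    qed
    have valR: "valid k (Node None rs)" "tree_word k (Node None rs) = R" "set (labels (Node None rs)) = set R"
      using f[of R] lab[of R] rs by auto
    \<comment> \<open>The root labels in \<open>rs\<close> are letters of \<open>R\<close>, so the
      new tree may stand to their left.\<close>
    have "m < the (label s)" if s: "s \<in> set rs" for s
    proof -
      obtain c vs where c: "s = Node (Some c) vs" using valR(1) s by (cases s) auto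
      then have "c \<in> set (labels (Node None rs))" using s by force
      then show ?thesis using valR(3) gt c by auto
    qed
    then have "valid k (Node None (Node (Some m) us # rs))" using val valR(1) by auto
    moreover have "tree_word k (Node None (Node (Some m) us # rs)) = w"
      using word valR(2) w(1) by simp
    ultimately show ?thesis by (intro exI[of _ "Node None (Node (Some m) us # rs)"]) simp
  qed
qed

section \<open>The Stirling property of tree words\<close>

lemma stirling_concat:
  assumes "\<And>xs. xs \<in> set xss \<Longrightarrow> stirling xs"
    and "sorted_wrt (\<lambda>xs ys. set xs \<inter> set ys = {}) xss"
  shows "stirling (concat xss)"
  using assms
proof (induction xss)
  case (Cons xs xss)
  then have "stirling xs" "stirling (concat xss)" "set xs \<inter> set (concat xss) = {}" by auto
  then show ?case using stirling_append[of xs "concat xss"] by auto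
qed simp

text \<open>Copies of \<open>m\<close> may enclose blocks, which is harmless because
  \<open>m\<close> is smaller than their letters; the blocks themselves share no letters.\<close>

lemma stirling_terminate_by:
  assumes "\<And>xs. xs \<in> set xss \<Longrightarrow> stirling xs \<and> (\<forall>b\<in>set xs. m < b)"
    and "sorted_wrt (\<lambda>xs ys. set xs \<inter> set ys = {}) xss"
  shows "stirling (terminate_by m xss)"
  using assms
proof (induction xss)
  case (Cons xs xss)
  let ?v = "terminate_by m xss"
  have v: "stirling ?v" by (rule Cons.IH) (use Cons.prems in auto)
  have big: "m < b" if "xs' \<in> set (xs # xss)" "b \<in> set xs'" for xs' b
    using Cons.prems(1) that by blast
  have setv: "set ?v \<subseteq> insert m (\<Union> (set ` set xss))" by auto
  have gt: "m \<le> b" if "b \<in> set (m # ?v)" for b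
  proof -
    have "b \<in> insert m (\<Union> (set ` set xss))"
      using that setv by (metis insertE insertI1 list.simps(15) subsetD)
    then show ?thesis using big by (auto intro: less_imp_le)
  qed
  have "stirling (m # ?v)" using stirling_append[of "[m]" ?v] v gt by auto
  moreover have "set xs \<inter> \<Union> (set ` set xss) = {}" using Cons.prems(2) by auto
  then have "set xs \<inter> set (m # ?v) = {}" using setv big[of xs m] by (simp del: set_concat) blast
  ultimately have "stirling (xs @ m # ?v)"
    using stirling_append[of xs "m # ?v"] Cons.prems(1) by auto
  then show ?case by simp
qed simp

lemma distinct_concat_disjoint:
  "distinct (concat xss) \<Longrightarrow> sorted_wrt (\<lambda>xs ys. set xs \<inter> set ys = {}) xss"
  by (induction xss) auto

text \<open>Distinct labels make the words of different children disjoint, so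
  \<open>stirling_concat\<close> applies at unlabeled nodes and \<open>stirling_terminate_by\<close>
  at labeled ones.\<close>

lemma stirling_tree_word:
  assumes "k \<ge> 1" "valid k t" "distinct (labels t)"
  shows "stirling (tree_word k t)"
  using assms
proof (induction k t rule: tree_word.induct)
  case (1 k ts)
  have "sorted_wrt (\<lambda>xs ys. set xs \<inter> set ys = {}) (map (tree_word k) ts)"
    using distinct_concat_disjoint[of "map labels ts"] 1
    by (auto simp: sorted_wrt_map set_tree_word elim!: sorted_wrt_mono_rel[rotated])
  moreover have "distinct (labels t)" if "t \<in> set ts" for t
    using 1 that by (auto simp: distinct_concat_iff)
  ultimately show ?case using stirling_concat[of "map (tree_word k) ts"] 1 by auto
next
  case (2 k a ts)
  show ?case
  proof (cases "ts = []")
    case False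
    have "sorted_wrt (\<lambda>xs ys. set xs \<inter> set ys = {}) (map (tree_word k) ts)"
      using distinct_concat_disjoint[of "map labels ts"] 2
      by (auto simp: sorted_wrt_map set_tree_word elim!: sorted_wrt_mono_rel[rotated])
    moreover have "distinct (labels t)" if "t \<in> set ts" for t
      using 2 that by (auto simp: distinct_concat_iff)
    ultimately have "stirling (terminate_by a (map (tree_word k) ts))"
      using 2 False by (intro stirling_terminate_by) (auto simp: set_tree_word)
    then show ?thesis using False by (simp add: comp_def)
  qed simp
qed

subsection \<open>Node addresses\<close>

lemma nodes_Node:
  "nodes (Node x ts) = insert [] (\<Union>i<length ts. (#) i ` nodes (ts ! i))"
proof (rule set_eqI)
  fix p show "p \<in> nodes (Node x ts) \<longleftrightarrow> p \<in> insert [] (\<Union>i<length ts. (#) i ` nodes (ts ! i))"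
    by (cases p) (auto simp: nodes_def)
qed

lemma Nil_in_nodes [simp]: "[] \<in> nodes t"
  by (simp add: nodes_def)

lemma Cons_in_nodes [simp]:
  "i # p \<in> nodes t \<longleftrightarrow> i < length (children t) \<and> p \<in> nodes (children t ! i)"
  by (simp add: nodes_def)

lemma append_in_nodes: "p @ q \<in> nodes t \<longleftrightarrow> p \<in> nodes t \<and> q \<in> nodes (subtree_at t p)"
  by (induction p arbitrary: t) auto

lemma subtree_at_append: "subtree_at t (p @ q) = subtree_at (subtree_at t p) q"
  by (induction p arbitrary: t) auto

lemma ball_nodes:
  "(\<forall>p\<in>nodes t. P p) \<longleftrightarrow> P [] \<and> (\<forall>i<length (children t). \<forall>p\<in>nodes (children t ! i). P (i # p))"
  by (cases t) (auto simp: nodes_Node)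

lemma ball_children: "(\<forall>t\<in>set ts. P t) \<longleftrightarrow> (\<forall>i<length ts. P (ts ! i))"
  by (metis in_set_conv_nth)

lemma finite_nodes: "finite (nodes t)"
  by (induction t) (simp add: nodes_Node)

subsection \<open>Pruned even trees\<close>

text \<open>Local description of pruned trees, where \<open>ev\<close> tells whether the root counts
  as being on an even level.\<close>

fun pruned_shape :: "nat \<Rightarrow> bool \<Rightarrow> 'a ptree \<Rightarrow> bool" where
  "pruned_shape k ev (Node x ts) \<longleftrightarrow>
     (ev \<longrightarrow> ts = [] \<or> length ts = k \<and> (\<exists>t\<in>set ts. \<not> is_leaf t)) \<and>
     (\<forall>t\<in>set ts. pruned_shape k (\<not> ev) t)"

text \<open>A right inverse of pruning. The restored leaves copy the label \<open>x\<close> because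
  the label type is arbitrary and some value is required.\<close>

fun unprune :: "nat \<Rightarrow> bool \<Rightarrow> 'a ptree \<Rightarrow> 'a ptree" where
  "unprune k ev (Node x ts) =
     Node x (if ev \<and> ts = [] then replicate k (Node x []) else map (unprune k (\<not> ev)) ts)"

text \<open>\<open>even_kary\<close> relative to the parity of the root, so that it can be passed to
  the children.\<close>

definition kary_at :: "nat \<Rightarrow> bool \<Rightarrow> 'a ptree \<Rightarrow> bool" where
  "kary_at k ev t \<longleftrightarrow>
     (\<forall>p\<in>nodes t. even (length p) = ev \<longrightarrow> length (children (subtree_at t p)) = k)"

lemma kary_at_Node:
  "kary_at k ev (Node x ts) \<longleftrightarrow> (ev \<longrightarrow> length ts = k) \<and> (\<forall>t\<in>set ts. kary_at k (\<not> ev) t)"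
  unfolding kary_at_def ball_children by (subst ball_nodes) auto

lemma even_kary_iff: "even_kary k t \<longleftrightarrow> kary_at k True t"
  by (auto simp: even_kary_def kary_at_def even_nodes_def)

text \<open>Only even-level nodes lose children, so pruning deeper down creates no new leaves on odd
  levels.\<close>

lemma is_leaf_prune_odd: "is_leaf (prune_from False t) \<longleftrightarrow> is_leaf t"
  by (cases t) (simp add: is_leaf_def)

lemma pruned_shape_prune:
  "kary_at k ev t \<Longrightarrow> pruned_shape k ev (prune_from ev t)"
proof (induction t arbitrary: ev)
  case (Node x ts)
  then show ?case by (cases ev) (auto simp: kary_at_Node is_leaf_prune_odd)
qed

lemma kary_at_unprune: "pruned_shape k ev t \<Longrightarrow> kary_at k ev (unprune k ev t)"
proof (induction t arbitrary: ev)
  case (Node x ts)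
  then show ?case by (auto simp: kary_at_Node)
qed

lemma is_leaf_unprune_odd: "is_leaf (unprune k False t) \<longleftrightarrow> is_leaf t"
  by (cases t) (simp add: is_leaf_def)

text \<open>Restored children are leaves and get deleted again. Any other even-level node has a
  nonleaf child, which stays a nonleaf, so nothing is deleted there.\<close>

lemma prune_unprune: "pruned_shape k ev t \<Longrightarrow> prune_from ev (unprune k ev t) = t"
proof (induction t arbitrary: ev)
  case (Node x ts)
  have "map (prune_from (\<not> ev) \<circ> unprune k (\<not> ev)) ts = ts"
    using Node by (intro map_idI) auto
  then show ?case using Node.prems
    by (cases ev; cases "ts = []") (auto simp: is_leaf_unprune_odd is_leaf_def[of "Node x []"])
qed

lemma pruned_even_kary_iff: "pruned_even_kary k t \<longleftrightarrow> pruned_shape k True t"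
  unfolding pruned_even_kary_def prune_def even_kary_iff
  using pruned_shape_prune[of k True] kary_at_unprune[of k True t] prune_unprune[of k True t] by metis

lemma pruned_shape_shape: "pruned_shape k ev (shape t) \<longleftrightarrow> pruned_shape k ev t"
proof (induction t arbitrary: ev)
  case (Node x ts)
  have "is_leaf (map_ptree (\<lambda>_. ()) t) \<longleftrightarrow> is_leaf t" for t :: "'a ptree"
    by (cases t) (simp add: is_leaf_def)
  then show ?case using Node by (simp add: shape_def)
qed

subsection \<open>Increasing labels\<close>

text \<open>Selects by label instead of level, so inductions need no parity; it agrees with
  \<open>even_nodes\<close> on alternating trees.\<close>

definition labeled_nodes :: "nat option ptree \<Rightarrow> nat list set" where
  "labeled_nodes t = {p \<in> nodes t. label_at t p \<noteq> None}"

lemma label_at_Nil [simp]: "label_at t [] = label t"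
  by (simp add: label_at_def)

lemma label_at_Cons [simp]: "label_at t (i # p) = label_at (children t ! i) p"
  by (simp add: label_at_def)

lemma labeled_nodes_Node:
  "labeled_nodes (Node x ts) =
     (if x = None then {} else {[]}) \<union> (\<Union>i<length ts. (#) i ` labeled_nodes (ts ! i))"
  by (auto simp: labeled_nodes_def nodes_Node)

lemma finite_labeled_nodes: "finite (labeled_nodes t)"
  by (simp add: labeled_nodes_def finite_nodes)

lemma set_labels: "Some ` set (labels t) = label_at t ` labeled_nodes t"
proof (induction t)
  case (Node x ts)
  have "Some ` (\<Union>t\<in>set ts. set (labels t)) = (\<Union>i<length ts. label_at (ts ! i) ` labeled_nodes (ts ! i))"
    using Node by (auto simp: set_conv_nth image_UN)
  moreover have "label_at (Node x ts) ` labeled_nodes (Node x ts) =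
    (if x = None then {} else {x}) \<union> (\<Union>i<length ts. label_at (ts ! i) ` labeled_nodes (ts ! i))"
    by (simp add: labeled_nodes_Node image_Un image_UN image_image)
  ultimately show ?case by (auto simp: image_Un split: option.splits)
qed

lemma length_labels: "length (labels t) = card (labeled_nodes t)"
proof (induction t)
  case (Node x ts)
  have "card (\<Union>i<length ts. (#) i ` labeled_nodes (ts ! i)) = (\<Sum>i<length ts. card (labeled_nodes (ts ! i)))"
    by (subst card_UN_disjoint) (auto simp: finite_labeled_nodes card_image)
  also have "\<dots> = (\<Sum>t\<leftarrow>ts. length (labels t))"
    using Node by (simp add: sum_list_sum_nth atLeast0LessThan)
  finally have "card (\<Union>i<length ts. (#) i ` labeled_nodes (ts ! i)) = (\<Sum>t\<leftarrow>ts. length (labels t))" .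
  moreover have "card (labeled_nodes (Node x ts)) =
      (if x = None then 0 else 1) + card (\<Union>i<length ts. (#) i ` labeled_nodes (ts ! i))"
    unfolding labeled_nodes_Node by (subst card_Un_disjoint) (auto simp: finite_labeled_nodes)
  ultimately show ?case by (simp add: length_concat comp_def split: option.splits)
qed

text \<open>The list has one entry per labeled node, so it is distinct exactly if the number of its
  values equals the number of labeled nodes.\<close>

lemma distinct_labels: "distinct (labels t) \<longleftrightarrow> inj_on (label_at t) (labeled_nodes t)"
proof -
  have "card (set (labels t)) = card (label_at t ` labeled_nodes t)"
    by (metis set_labels card_image inj_Some)
  then show ?thesis
    by (metis length_labels card_distinct distinct_card card_image eq_card_imp_inj_on finite_labeled_nodes)
qed

lemma bij_label_at:
  "bij_betw (label_at t) (labeled_nodes t) (Some ` M) \<longleftrightarrow> distinct (labels t) \<and> set (labels t) = M"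
  unfolding bij_betw_def distinct_labels set_labels[symmetric] by (simp add: inj_image_eq_iff)

fun alternating :: "bool \<Rightarrow> nat option ptree \<Rightarrow> bool" where
  "alternating ev (Node x ts) \<longleftrightarrow> (x \<noteq> None) = ev \<and> (\<forall>t\<in>set ts. alternating (\<not> ev) t)"

lemma alternating_iff:
  "alternating ev t \<longleftrightarrow> (\<forall>p\<in>nodes t. (label_at t p \<noteq> None) = (even (length p) = ev))"
proof (induction t arbitrary: ev)
  case (Node x ts)
  have "(\<forall>t\<in>set ts. alternating (\<not> ev) t) \<longleftrightarrow>
     (\<forall>i<length ts. \<forall>p\<in>nodes (ts ! i). (label_at (ts ! i) p \<noteq> None) = (even (length p) = (\<not> ev)))"
    using Node by (simp add: ball_children)
  moreover have "(even (Suc n) = ev) = (even n = (\<not> ev))" for n by auto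
  ultimately show ?case by (subst ball_nodes) (simp del: even_Suc)
qed

text \<open>The order condition that \<open>valid\<close> imposes at a single node: on siblings at
  unlabeled nodes, on descendants at labeled ones.\<close>

fun increasing_at :: "nat option ptree \<Rightarrow> bool" where
  "increasing_at (Node None ts) \<longleftrightarrow> sorted_wrt (<) (map (the \<circ> label) ts)"
| "increasing_at (Node (Some a) ts) \<longleftrightarrow> (\<forall>t\<in>set ts. \<forall>b\<in>set (labels t). a < b)"

lemma valid_iff:
  "valid k t \<and> (label t \<noteq> None) = ev \<longleftrightarrow>
     pruned_shape k ev t \<and> alternating ev t \<and> (\<forall>p\<in>nodes t. increasing_at (subtree_at t p))"
proof (induction t arbitrary: ev)
  case (Node x ts)
  have inc: "(\<forall>p\<in>nodes (Node x ts). increasing_at (subtree_at (Node x ts) p)) \<longleftrightarrow>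
      increasing_at (Node x ts) \<and> (\<forall>t\<in>set ts. \<forall>p\<in>nodes t. increasing_at (subtree_at t p))"
    unfolding ball_children by (subst ball_nodes) simp
  have IH: "(\<forall>t\<in>set ts. (label t \<noteq> None) = (\<not> ev) \<and> valid k t) \<longleftrightarrow>
      (\<forall>t\<in>set ts. pruned_shape k (\<not> ev) t \<and> alternating (\<not> ev) t \<and>
        (\<forall>p\<in>nodes t. increasing_at (subtree_at t p)))"
    using Node[of _ "\<not> ev"] by blast
  show ?case
  proof (cases x)
    case None
    then show ?thesis using IH inc by (cases ev) auto
  next
    case (Some a)
    then show ?thesis using IH inc by (cases ev) auto
  qed
qed

text \<open>In an alternating tree the even-level nodes are the labeled ones. The path condition
  then becomes \<open>increasing_at\<close> at labeled nodes and the sibling condition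
  \<open>increasing_at\<close> at unlabeled nodes, so \<open>valid_iff\<close> applies.\<close>

lemma increasing_pruned_trees_eq:
  "increasing_pruned_trees M k =
     {T. label T \<noteq> None \<and> valid k T \<and> distinct (labels T) \<and> set (labels T) = M}"
proof (rule set_eqI)
  fix T :: "nat option ptree"
  define paths_inc where "paths_inc \<longleftrightarrow> (\<forall>p q. p \<in> even_nodes T \<and> p @ q \<in> even_nodes T \<and> q \<noteq> [] \<longrightarrow>
             the (label_at T p) < the (label_at T (p @ q)))"
  define sibs_inc where "sibs_inc \<longleftrightarrow> (\<forall>p i j. p @ [i] \<in> even_nodes T \<and> p @ [j] \<in> even_nodes T \<and> i < j \<longrightarrow>
             the (label_at T (p @ [i])) < the (label_at T (p @ [j])))"
  have inc: "paths_inc \<and> sibs_inc \<longleftrightarrow> (\<forall>p\<in>nodes T. increasing_at (subtree_at T p))"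
    if alt: "alternating True T"
  proof -
    have even_iff: "p \<in> even_nodes T \<longleftrightarrow> p \<in> nodes T \<and> label_at T p \<noteq> None" for p
      using alt by (auto simp: alternating_iff even_nodes_def)
    have odd_iff: "p \<in> nodes T \<Longrightarrow> odd (length p) \<longleftrightarrow> label_at T p = None" for p
      using alt by (auto simp: alternating_iff)
    have paths: "paths_inc \<longleftrightarrow>
        (\<forall>p\<in>nodes T. \<forall>a ts. subtree_at T p = Node (Some a) ts \<longrightarrow> increasing_at (Node (Some a) ts))"
    proof (intro iffI ballI allI impI)
      fix p a ts assume *: paths_inc "p \<in> nodes T" "subtree_at T p = Node (Some a) ts"
      have "a < b" if b: "t \<in> set ts" "b \<in> set (labels t)" for t b
      proof -
        obtain i where i: "i < length ts" "ts ! i = t" using b by (auto simp: in_set_conv_nth)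
        have "Some b \<in> label_at t ` labeled_nodes t" using set_labels b(2) by blast
        then obtain q where q: "q \<in> nodes t" "label_at t q = Some b"
          by (auto simp: labeled_nodes_def)
        have "label_at T (p @ i # q) = Some b" "label_at T p = Some a"
          using * i q by (auto simp: label_at_def subtree_at_append)
        moreover have "p @ i # q \<in> nodes T" using * i q by (simp add: append_in_nodes)
        ultimately show ?thesis using *(1,2) unfolding paths_inc_def even_iff by fastforce
      qed
      then show "increasing_at (Node (Some a) ts)" by simp
    next
      assume *: "\<forall>p\<in>nodes T. \<forall>a ts. subtree_at T p = Node (Some a) ts \<longrightarrow> increasing_at (Node (Some a) ts)"
      show paths_inc
        unfolding paths_inc_def even_iff
      proof (intro allI impI, elim conjE)
        fix p q assume p: "p \<in> nodes T" "label_at T p \<noteq> None" "p @ q \<in> nodes T"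
          "label_at T (p @ q) \<noteq> None" "q \<noteq> []"
        obtain a ts where a: "subtree_at T p = Node (Some a) ts"
          using p(2) by (cases "subtree_at T p") (auto simp: label_at_def)
        obtain i q' where q: "q = i # q'" using p(5) by (cases q) auto
        obtain b where b: "label_at T (p @ q) = Some b" using p(4) by auto
        have i: "i < length ts" "q' \<in> nodes (ts ! i)" using p(3) a q by (auto simp: append_in_nodes)
        have "label_at (ts ! i) q' = Some b" using b a q by (simp add: label_at_def subtree_at_append)
        then have "Some b \<in> Some ` set (labels (ts ! i))"
          unfolding set_labels using i by (force simp: labeled_nodes_def)
        then have "b \<in> set (labels (ts ! i))" by auto
        moreover have "ts ! i \<in> set ts" using i by simp
        ultimately have "a < b" using *[rule_format, OF p(1) a] by simp
        then show "the (label_at T p) < the (label_at T (p @ q))" using a b by (simp add: label_at_def)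
      qed
    qed
    have sibs: "sibs_inc \<longleftrightarrow>
        (\<forall>p\<in>nodes T. \<forall>ts. subtree_at T p = Node None ts \<longrightarrow> increasing_at (Node None ts))"
    proof (intro iffI ballI allI impI)
      fix p ts assume *: sibs_inc "p \<in> nodes T" "subtree_at T p = Node None ts"
      have "odd (length p)" using odd_iff * by (simp add: label_at_def)
      then have "the (label (ts ! i)) < the (label (ts ! j))" if "i < j" "j < length ts" for i j
        using *(1)[unfolded sibs_inc_def, rule_format, of p i j] * that
        by (auto simp: even_nodes_def append_in_nodes label_at_def subtree_at_append)
      then show "increasing_at (Node None ts)" by (simp add: sorted_wrt_iff_nth_less)
    next
      assume *: "\<forall>p\<in>nodes T. \<forall>ts. subtree_at T p = Node None ts \<longrightarrow> increasing_at (Node None ts)"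
      show sibs_inc
        unfolding sibs_inc_def
      proof (intro allI impI, elim conjE)
        fix p i j assume p: "p @ [i] \<in> even_nodes T" "p @ [j] \<in> even_nodes T" "i < j"
        then have "p \<in> nodes T" "odd (length p)" by (auto simp: even_nodes_def append_in_nodes)
        then obtain ts where ts: "subtree_at T p = Node None ts"
          using odd_iff by (cases "subtree_at T p") (auto simp: label_at_def)
        have "j < length ts" using p(2) ts by (simp add: even_nodes_def append_in_nodes)
        moreover have "increasing_at (Node None ts)" using * \<open>p \<in> nodes T\<close> ts by blast
        ultimately show "the (label_at T (p @ [i])) < the (label_at T (p @ [j]))"
          using p(3) ts by (simp add: sorted_wrt_iff_nth_less label_at_def subtree_at_append)
      qed
    qed
    have "increasing_at (subtree_at T p) \<longleftrightarrow>
      (\<forall>a ts. subtree_at T p = Node (Some a) ts \<longrightarrow> increasing_at (Node (Some a) ts)) \<and>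
      (\<forall>ts. subtree_at T p = Node None ts \<longrightarrow> increasing_at (Node None ts))" for p
      by (metis option.exhaust ptree.exhaust)
    then show ?thesis unfolding paths sibs by blast
  qed
  have bij: "bij_betw (label_at T) (even_nodes T) (Some ` M)
        \<and> (\<forall>p \<in> nodes T. odd (length p) \<longrightarrow> label_at T p = None) \<longleftrightarrow>
      alternating True T \<and> distinct (labels T) \<and> set (labels T) = M"
  proof -
    have ev: "even_nodes T = labeled_nodes T" if "alternating True T"
      using that by (auto simp: alternating_iff even_nodes_def labeled_nodes_def)
    have "alternating True T" if b: "bij_betw (label_at T) (even_nodes T) (Some ` M)"
      "\<forall>p \<in> nodes T. odd (length p) \<longrightarrow> label_at T p = None"
    proof -
      \<comment> \<open>The values of the bijection lie in the range of \<open>Some\<close>.\<close>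
      have "label_at T p \<noteq> None" if p: "p \<in> even_nodes T" for p
        using bij_betwE[OF b(1)] p by auto
      then show ?thesis using b(2) by (auto simp: alternating_iff even_nodes_def)
    qed
    moreover have "label_at T p = None" if "alternating True T" "p \<in> nodes T" "odd (length p)" for p
      using that by (auto simp: alternating_iff)
    ultimately show ?thesis using bij_label_at[of T M] ev by metis
  qed
  have "T \<in> increasing_pruned_trees M k \<longleftrightarrow> pruned_shape k True T \<and>
      (bij_betw (label_at T) (even_nodes T) (Some ` M)
        \<and> (\<forall>p \<in> nodes T. odd (length p) \<longrightarrow> label_at T p = None)) \<and> paths_inc \<and> sibs_inc"
    by (simp add: increasing_pruned_trees_def pruned_even_kary_iff pruned_shape_shape
        paths_inc_def sibs_inc_def)
  also have "\<dots> \<longleftrightarrow> (pruned_shape k True T \<and> alternating True T \<and>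
      (\<forall>p\<in>nodes T. increasing_at (subtree_at T p))) \<and> distinct (labels T) \<and> set (labels T) = M"
    using bij inc by blast
  also have "\<dots> \<longleftrightarrow> T \<in> {T. label T \<noteq> None \<and> valid k T \<and> distinct (labels T) \<and> set (labels T) = M}"
    unfolding valid_iff[of k T True, symmetric] by auto
  finally show "T \<in> increasing_pruned_trees M k \<longleftrightarrow>
    T \<in> {T. label T \<noteq> None \<and> valid k T \<and> distinct (labels T) \<and> set (labels T) = M}" .
qed

subsection \<open>Longest ascent-plateaux and labeled leaves\<close>

text \<open>
  Looking only at the first copy of \<open>a\<close> loses nothing: when \<open>a\<close> occurs exactly \<open>k\<close> times, a
  plateau of length \<open>k\<close> uses up all copies.
\<close>

definition plateau_letter :: "nat \<Rightarrow> nat list \<Rightarrow> nat \<Rightarrow> bool" where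
  "plateau_letter k w a \<longleftrightarrow> a \<in> set w \<and> takeWhile (\<lambda>x. x \<noteq> a) w \<noteq> [] \<and>
     last (takeWhile (\<lambda>x. x \<noteq> a) w) < a \<and> take k (dropWhile (\<lambda>x. x \<noteq> a) w) = replicate k a"

lemma takeWhile_dropWhile_neq:
  assumes "a \<notin> set xs"
  shows "takeWhile (\<lambda>x. x \<noteq> a) (xs @ v) = xs @ takeWhile (\<lambda>x. x \<noteq> a) v"
    and "dropWhile (\<lambda>x. x \<noteq> a) (xs @ v) = dropWhile (\<lambda>x. x \<noteq> a) v"
  using assms by (induction xs) auto

text \<open>Since all copies of \<open>a\<close> lie in \<open>v\<close>, the prefix matters only
  through its last letter, and \<open>ys\<close> cannot complete the run. This passes the question
  to the word of a subtree with a single letter in front.\<close>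

lemma plateau_letter_infix:
  assumes "P \<noteq> []" "a \<notin> set P" "a \<in> set v" "a \<notin> set ys"
  shows "plateau_letter k (P @ v @ ys) a \<longleftrightarrow> plateau_letter k (last P # v) a"
proof -
  let ?t = "takeWhile (\<lambda>x. x \<noteq> a)" and ?d = "dropWhile (\<lambda>x. x \<noteq> a)"
  have lP: "last P \<noteq> a" using assms by auto
  have t: "?t (P @ v @ ys) = P @ ?t v" "?t (last P # v) = last P # ?t v"
    using assms takeWhile_dropWhile_neq(1)[OF assms(2)] lP by auto
  have d: "?d (P @ v @ ys) = ?d v @ ys" "?d (last P # v) = ?d v"
    using assms takeWhile_dropWhile_neq(2)[OF assms(2)] lP by auto
  have "take k (?d v @ ys) = replicate k a \<longleftrightarrow> take k (?d v) = replicate k a"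
  proof (cases "k \<le> length (?d v)")
    case True
    then show ?thesis by simp
  next
    case False
    \<comment> \<open>The missing letters of the run would have to come from \<open>ys\<close>,
      which contains no \<open>a\<close>.\<close>
    have "take k (?d v @ ys) \<noteq> replicate k a"
    proof
      assume *: "take k (?d v @ ys) = replicate k a"
      have "length (take k (?d v @ ys)) = k" using * by simp
      then have "take (k - length (?d v)) ys \<noteq> []" using False by auto
      then obtain b where b: "b \<in> set (take (k - length (?d v)) ys)" by (meson last_in_set)
      then have "b \<in> set (take k (?d v @ ys))" by simp
      then have "b = a" unfolding * by simp
      then show False using b assms(4) in_set_takeD by fast
    qed
    moreover have "length (take k (?d v)) \<noteq> length (replicate k a)" using False by simp
    then have "take k (?d v) \<noteq> replicate k a" by metis
    ultimately show ?thesis by blast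
  qed
  then show ?thesis using assms lP by (simp add: plateau_letter_def t d)
qed

text \<open>All \<open>k\<close> copies of \<open>a\<close> sit at positions \<open>i + 1\<close> to
  \<open>i + k\<close>, so \<open>i + 1\<close> is the first occurrence and \<open>i\<close> can be
  recovered from \<open>a\<close>.\<close>

lemma longest_ascent_plateauD:
  assumes "k \<ge> 1" "\<forall>a\<in>set w. count (mset w) a = k" "longest_ascent_plateau k w i"
  defines "a \<equiv> w ! (i + 1)"
  shows "plateau_letter k w a" "length (takeWhile (\<lambda>x. x \<noteq> a) w) = i + 1"
proof -
  define xs ys where "xs = take (i + 1) w" and "ys = drop (i + 1 + k) w"
  have len: "i + k < length w" and asc: "w ! i < a"
    and all: "\<And>j. j \<in> {1..k} \<Longrightarrow> w ! (i + j) = a"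
    using assms by (auto simp: longest_ascent_plateau_def)
  have "take k (drop (i + 1) w) = replicate k a"
  proof (rule nth_equalityI)
    show "length (take k (drop (i + 1) w)) = length (replicate k a)" using len by simp
    fix j assume "j < length (take k (drop (i + 1) w))"
    then show "take k (drop (i + 1) w) ! j = replicate k a ! j"
      using len all[of "j + 1"] by simp
  qed
  then have w: "w = xs @ replicate k a @ ys"
    unfolding xs_def ys_def by (metis append_take_drop_id drop_drop add.commute)
  have "a \<in> set w" using len assms(1) by (simp add: a_def)
  then have "count (mset w) a = k" using assms(2) by blast
  then have "count (mset xs) a = 0" unfolding w by simp
  then have a: "a \<notin> set xs" by (metis count_mset_0_iff)
  obtain k' where k': "k = Suc k'" using assms(1) by (cases k) auto
  have xs: "length xs = i + 1" using len by (simp add: xs_def)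
  then have "last xs = xs ! i" by (cases xs rule: rev_cases) auto
  then have "last xs = w ! i" by (simp add: xs_def)
  moreover have "takeWhile (\<lambda>x. x \<noteq> a) w = xs" "dropWhile (\<lambda>x. x \<noteq> a) w = replicate k a @ ys"
    unfolding w takeWhile_dropWhile_neq[OF a] by (simp_all add: k')
  ultimately show "plateau_letter k w a" "length (takeWhile (\<lambda>x. x \<noteq> a) w) = i + 1"
    using \<open>a \<in> set w\<close> asc xs by (auto simp: plateau_letter_def)
qed

text \<open>Converse direction: \<open>i\<close> is the position just before the first
  \<open>a\<close>, hence the subtraction of 1.\<close>

lemma plateau_letterD:
  assumes "k \<ge> 1" "plateau_letter k w a"
  defines "i \<equiv> length (takeWhile (\<lambda>x. x \<noteq> a) w) - 1"
  shows "longest_ascent_plateau k w i" "w ! (i + 1) = a"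
proof -
  define xs where "xs = takeWhile (\<lambda>x. x \<noteq> a) w"
  define ys where "ys = dropWhile (\<lambda>x. x \<noteq> a) w"
  have w: "w = xs @ ys" by (simp add: xs_def ys_def)
  have xs: "xs \<noteq> []" "last xs < a" and ys: "take k ys = replicate k a"
    using assms(2) by (auto simp: plateau_letter_def xs_def ys_def)
  have i: "length xs = Suc i" using xs(1) by (cases xs) (auto simp: i_def xs_def)
  have len: "k \<le> length ys" using ys by (metis length_replicate length_take min.absorb_iff1 min.commute)
  have ysj: "ys ! j = a" if "j < k" for j
    using ys that by (metis nth_replicate nth_take)
  have all: "w ! (i + j) = a" if j: "1 \<le> j" "j \<le> k" for j
  proof -
    obtain j' where j': "j = Suc j'" using j(1) by (cases j) auto
    show ?thesis using ysj[of j'] j i by (simp add: w nth_append j')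
  qed
  show first: "w ! (i + 1) = a" using all[of 1] assms(1) by simp
  have "w ! i = last xs" using i xs(1) by (simp add: w nth_append last_conv_nth)
  moreover have "i + k < length w" using len i by (simp add: w)
  ultimately show "longest_ascent_plateau k w i"
    using xs(2) first all by (simp add: longest_ascent_plateau_def)
qed

lemma ap_eq_card_plateau_letters:
  assumes "k \<ge> 1" "\<forall>a\<in>set w. count (mset w) a = k"
  shows "ap k w = card {a. plateau_letter k w a}"
proof -
  have "bij_betw (\<lambda>i. w ! (i + 1)) {i. longest_ascent_plateau k w i} {a. plateau_letter k w a}"
    by (rule bij_betw_byWitness[where f' = "\<lambda>a. length (takeWhile (\<lambda>x. x \<noteq> a) w) - 1"])
      (use longest_ascent_plateauD[OF assms] plateau_letterD[OF assms(1)] in auto)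
  then show ?thesis unfolding ap_def by (rule bij_betw_same_card)
qed

section \<open>Plateau letters are leaf labels\<close>

definition leaf_labels :: "nat option ptree \<Rightarrow> nat set" where
  "leaf_labels t = {a. \<exists>p\<in>nodes t. subtree_at t p = Node (Some a) []}"

lemma leaf_labels_Node:
  "leaf_labels (Node x ts) = (if ts = [] then set_option x else {}) \<union> (\<Union>t\<in>set ts. leaf_labels t)"
proof -
  have "(\<exists>p\<in>nodes (Node x ts). subtree_at (Node x ts) p = Node (Some a) []) \<longleftrightarrow>
      Node x ts = Node (Some a) [] \<or> (\<exists>t\<in>set ts. \<exists>p\<in>nodes t. subtree_at t p = Node (Some a) [])" for a
    by (auto simp: nodes_Node set_conv_nth)
  then show ?thesis by (cases x) (auto simp: leaf_labels_def)
qed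

lemma leaf_labels_subset: "leaf_labels t \<subseteq> set (labels t)"
proof (induction t)
  case (Node x ts)
  then show ?case by (cases x) (auto simp: leaf_labels_Node)
qed

text \<open>Every block at the root is closed by \<open>a\<close>. Consequently the word of a right
  sibling is preceded by the root label of its left neighbor.\<close>

lemma tree_word_root:
  assumes "valid k (Node (Some a) ts)" "k \<ge> 1"
  shows "tree_word k (Node (Some a) ts) \<noteq> [] \<and> last (tree_word k (Node (Some a) ts)) = a"
proof -
  have "unpruned k ts \<noteq> []" using valid_unpruned(1)[OF assms(1)] assms(2) by auto
  then obtain us t where "unpruned k ts = us @ [t]" by (metis rev_exhaust)
  then show ?thesis unfolding tree_word_unpruned by simp
qed

text \<open>The first block is free of \<open>m\<close>, so it can only be empty if the word starts
  with \<open>m\<close>; then proceed to the next block.\<close>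

lemma take_terminate_by:
  assumes "take (length Ws) (terminate_by m Ws) = replicate (length Ws) m" "\<forall>W\<in>set Ws. m \<notin> set W"
  shows "\<forall>W\<in>set Ws. W = []"
  using assms
proof (induction Ws)
  case (Cons W Ws)
  then have "W = []" by (cases W) auto
  then show ?case using Cons by simp
qed simp

text \<open>With \<open>m\<close> in front of each block, the last block starts only after all
  \<open>length Ws\<close> copies of \<open>m\<close>; it is therefore unconstrained, which explains
  \<open>butlast\<close>.\<close>

lemma take_concat_Cons:
  assumes "Ws \<noteq> []" "\<forall>W\<in>set Ws. m \<notin> set W"
  shows "take (length Ws) (concat (map ((#) m) Ws)) = replicate (length Ws) m \<longleftrightarrow>
    (\<forall>W\<in>set (butlast Ws). W = [])"
  using assms
proof (induction Ws rule: list_nonempty_induct)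
  case (cons W Ws)
  then show ?case by (cases W; cases Ws) auto
qed simp

lemma distinct_labels_split:
  assumes "distinct (labels (Node x (us @ t # vs)))" "a \<in> set (labels t)"
  shows "distinct (labels t)" "\<And>s. s \<in> set us \<union> set vs \<Longrightarrow> a \<notin> set (labels s)" "x \<noteq> Some a"
    and "a \<in> leaf_labels (Node x (us @ t # vs)) \<longleftrightarrow> a \<in> leaf_labels t"
proof -
  show *: "distinct (labels t)" "\<And>s. s \<in> set us \<union> set vs \<Longrightarrow> a \<notin> set (labels s)" "x \<noteq> Some a"
    using assms by (cases x; auto)+
  show "a \<in> leaf_labels (Node x (us @ t # vs)) \<longleftrightarrow> a \<in> leaf_labels t"
    using *(2) leaf_labels_subset by (auto simp: leaf_labels_Node)
qed

text \<open>Induction on the tree for any lower bound \<open>c\<close> of its labels placed in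
  front. If \<open>a\<close> lies inside a child, the last letter before the word of that child
  serves as the new \<open>c\<close>. Since \<open>a \<noteq> c\<close>, the step up from
  \<open>c\<close> to \<open>a\<close> is strict.\<close>

lemma plateau_letter_tree_word:
  assumes "k \<ge> 1" "valid k t" "distinct (labels t)" "\<And>b. b \<in> set (labels t) \<Longrightarrow> c \<le> b"
    and "a \<in> set (labels t)" "a \<noteq> c"
  shows "plateau_letter k (c # tree_word k t) a \<longleftrightarrow> a \<in> leaf_labels t"
  using assms
proof (induction k t arbitrary: c rule: tree_word.induct)
  case (1 k ts)
  obtain t where t: "t \<in> set ts" "a \<in> set (labels t)" using 1(6) by auto
  obtain us vs where ts: "ts = us @ t # vs" using split_list t(1) by fast
  note split = distinct_labels_split[OF 1(4)[unfolded ts] t(2)]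
  have val: "valid k s" "label s \<noteq> None" if "s \<in> set ts" for s using 1(3) that by auto
  have word: "set (tree_word k s) = set (labels s)" if "s \<in> set ts" for s
    using set_tree_word val that 1(2) by blast
  \<comment> \<open>The last letter of \<open>P\<close> is \<open>c\<close> or the root label of the
    left neighbor of \<open>t\<close>.\<close>
  define P where "P = c # concat (map (tree_word k) us)"
  have "a \<notin> set P" using split(2) word 1(7) by (auto simp: P_def ts)
  moreover have "last P \<le> b" if b: "b \<in> set (labels t)" for b
  proof (cases us rule: rev_cases)
    case Nil
    then show ?thesis using 1(5) b t(1) by (auto simp: P_def)
  next
    case (snoc us' s)
    then have s: "s \<in> set ts" by (simp add: ts)
    obtain m ms where m: "s = Node (Some m) ms" using val(2)[OF s] by (cases s) auto
    obtain n ns where n: "t = Node (Some n) ns" using val(2)[OF t(1)] by (cases t) auto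
    have "last P = m" using tree_word_root[of k m ms] val(1)[OF s] m 1(2) by (simp add: P_def snoc)
    moreover have "m < n" using 1(3) m n by (simp add: ts snoc sorted_wrt_append)
    moreover have "n \<le> b" using labels_ge_root val(1)[OF t(1)] b n by blast
    ultimately show ?thesis by simp
  qed
  moreover have "a \<noteq> last P" using \<open>a \<notin> set P\<close> by (metis P_def last_in_set list.discI)
  ultimately have "plateau_letter k (last P # tree_word k t) a \<longleftrightarrow> a \<in> leaf_labels t"
    using 1(1)[OF t(1) 1(2) val(1)[OF t(1)] split(1)] t(2) by blast
  moreover have "plateau_letter k (P @ tree_word k t @ concat (map (tree_word k) vs)) a \<longleftrightarrow>
      plateau_letter k (last P # tree_word k t) a"
    using \<open>a \<notin> set P\<close> t word split(2)
    by (intro plateau_letter_infix) (auto simp: P_def ts)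
  ultimately show ?case using split(4) by (simp add: P_def ts)
next
  case (2 k m ts)
  show ?case
  proof (cases "ts = []")
    case True
    then have "a = m" "c < m" using 2(5-7) by (auto simp: le_neq_implies_less)
    moreover obtain k' where "k = Suc k'" using 2(2) by (cases k) auto
    ultimately show ?thesis using True by (simp add: plateau_letter_def leaf_labels_Node)
  next
    case False
    have val: "valid k s" "label s = None" "\<And>b. b \<in> set (labels s) \<Longrightarrow> m < b" if "s \<in> set ts" for s
      using 2(3) that by auto
    have word: "set (tree_word k s) = set (labels s)" if "s \<in> set ts" for s
      using set_tree_word val that 2(2) by blast
    have len: "length ts = k" and nonleaf: "\<exists>t\<in>set ts. \<not> is_leaf t" using 2(3) False by auto
    have mfree: "\<forall>W\<in>set (map (tree_word k) ts). m \<notin> set W" using word val(3) by auto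
    show ?thesis
    proof (cases "a = m")
      case True
      have "m \<notin> leaf_labels (Node (Some m) ts)"
        using False val(3) leaf_labels_subset by (auto simp: leaf_labels_Node)
      \<comment> \<open>An ascent to the first \<open>m\<close> forces the first block to be empty,
        as its letters exceed \<open>m\<close>. A run of \<open>k\<close> copies then makes all
        blocks empty, contradicting the nonleaf child.\<close>
      moreover have "\<not> plateau_letter k (c # tree_word k (Node (Some m) ts)) m"
      proof
        assume *: "plateau_letter k (c # tree_word k (Node (Some m) ts)) m"
        obtain s ss where ts: "ts = s # ss" using False by (cases ts) auto
        have c: "c \<noteq> m" using 2(7) True by simp
        have "m \<notin> set (c # tree_word k s)" using c mfree ts by simp
        note tw = takeWhile_dropWhile_neq[OF this]
        have eq: "c # tree_word k (Node (Some m) ts) =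
            (c # tree_word k s) @ m # concat (map (\<lambda>t. tree_word k t @ [m]) ss)"
          by (simp add: ts)
        have "last (c # tree_word k s) < m"
          using * unfolding plateau_letter_def eq tw by simp
        then have "tree_word k s = []"
          using val(3)[of s "last (tree_word k s)"] word[of s] ts
          by (auto split: if_splits dest!: last_in_set)
        then have "take k (terminate_by m (map (tree_word k) ts)) = replicate k m"
          using * unfolding plateau_letter_def eq tw by (simp add: ts comp_def)
        then have "\<forall>W\<in>set (map (tree_word k) ts). W = []"
          using mfree len by (intro take_terminate_by) auto
        then show False using nonleaf tree_word_Nil_iff val(1,2) 2(2) by auto
      qed
      ultimately show ?thesis using True by simp
    next
      case am: False
      obtain t where t: "t \<in> set ts" "a \<in> set (labels t)" using 2(6) am by auto
      obtain us vs where ts: "ts = us @ t # vs" using split_list t(1) by fast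
      note split = distinct_labels_split[OF 2(4)[unfolded ts] t(2)]
      \<comment> \<open>The last letter of \<open>P\<close> is now \<open>c\<close> or
        \<open>m\<close>.\<close>
      define P where "P = c # concat (map (\<lambda>t. tree_word k t @ [m]) us)"
      have "a \<notin> set P" using split(2) word 2(7) am by (auto simp: P_def ts)
      moreover have "last P \<le> b" if b: "b \<in> set (labels t)" for b
      proof (cases us rule: rev_cases)
        case Nil
        then show ?thesis using 2(5) b t(1) by (auto simp: P_def)
      next
        case (snoc us' s)
        then show ?thesis using val(3)[OF t(1) b] by (simp add: P_def)
      qed
      moreover have "a \<noteq> last P" using \<open>a \<notin> set P\<close> by (metis P_def last_in_set list.discI)
      ultimately have "plateau_letter k (last P # tree_word k t) a \<longleftrightarrow> a \<in> leaf_labels t"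
        using 2(1)[OF False t(1) 2(2) val(1)[OF t(1)] split(1)] t(2) by blast
      moreover have "plateau_letter k (P @ tree_word k t @ [m] @ concat (map (\<lambda>t. tree_word k t @ [m]) vs)) a \<longleftrightarrow>
          plateau_letter k (last P # tree_word k t) a"
        using \<open>a \<notin> set P\<close> t word split(2) am
        by (intro plateau_letter_infix) (auto simp: P_def ts)
      ultimately show ?thesis using split(4) by (simp add: P_def ts)
    qed
  qed
qed

subsection \<open>The bijection\<close>

lemma mset_eq_multiset_pow_iff:
  assumes "k \<ge> 1" "finite M"
  shows "mset w = multiset_pow M k \<longleftrightarrow> set w = M \<and> (\<forall>a\<in>set w. count (mset w) a = k)"
proof
  assume w: "mset w = multiset_pow M k"
  have "count (mset w) a = (if a \<in> M then k else 0)" for a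
    using assms by (simp add: w multiset_pow_def count_mset_set')
  moreover from this have "a \<in> set w \<longleftrightarrow> a \<in> M" for a
    using assms(1) count_mset_0_iff[of w a] by (auto split: if_splits)
  ultimately show "set w = M \<and> (\<forall>a\<in>set w. count (mset w) a = k)" by auto
next
  assume w: "set w = M \<and> (\<forall>a\<in>set w. count (mset w) a = k)"
  show "mset w = multiset_pow M k"
  proof (rule multiset_eqI)
    fix a show "count (mset w) a = count (multiset_pow M k) a"
      using w assms count_mset_0_iff[of w a] by (auto simp: multiset_pow_def count_mset_set')
  qed
qed

text \<open>The image of the trees before the final letter is moved to the front. Ending with the
  minimum means that nothing follows its last copy, so the encoded forest is a single tree.\<close>

definition min_last_words :: "nat set \<Rightarrow> nat \<Rightarrow> nat list set" where
  "min_last_words M k =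
     {w. stirling w \<and> set w = M \<and> (\<forall>a\<in>set w. count (mset w) a = k) \<and> last w = Min M}"

lemma rotate_bij:
  assumes "k \<ge> 1" "finite M" "M \<noteq> {}"
  shows "bij_betw (\<lambda>w. last w # butlast w) (min_last_words M k) (Qtilde M k)"
proof -
  have Q: "Min M # v \<in> Qtilde M k \<longleftrightarrow> v @ [Min M] \<in> min_last_words M k" for v
  proof -
    have "stirling (Min M # v) \<longleftrightarrow> stirling (v @ [Min M])" if "set (Min M # v) = M"
    proof (rule stirling_rotate_min)
      fix b assume "b \<in> set v"
      then have "b \<in> M" using that by auto
      then show "Min M \<le> b" using assms(2) by (rule Min_le[rotated])
    qed
    then show ?thesis
      unfolding Qtilde_def min_last_words_def stirling_permutation_of_def
        mset_eq_multiset_pow_iff[OF assms(1,2)] stirling_def[symmetric]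
      by auto
  qed
  show ?thesis
  proof (rule bij_betw_byWitness[where f' = "\<lambda>\<pi>. tl \<pi> @ [hd \<pi>]"])
    have ne: "w \<noteq> []" if "w \<in> min_last_words M k" for w
      using that assms(3) by (auto simp: min_last_words_def)
    show "\<forall>w\<in>min_last_words M k. tl (last w # butlast w) @ [hd (last w # butlast w)] = w"
      using ne by simp
    show "\<forall>\<pi>\<in>Qtilde M k. last (tl \<pi> @ [hd \<pi>]) # butlast (tl \<pi> @ [hd \<pi>]) = \<pi>"
    proof
      fix \<pi> assume "\<pi> \<in> Qtilde M k"
      then have "\<pi> \<noteq> []" by (simp add: Qtilde_def)
      then show "last (tl \<pi> @ [hd \<pi>]) # butlast (tl \<pi> @ [hd \<pi>]) = \<pi>" by simp
    qed
    show "(\<lambda>w. last w # butlast w) ` min_last_words M k \<subseteq> Qtilde M k"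
    proof (rule image_subsetI)
      fix w assume w: "w \<in> min_last_words M k"
      then have "last w = Min M" by (simp add: min_last_words_def)
      moreover from this have "w = butlast w @ [Min M]" using ne[OF w] by (metis append_butlast_last_id)
      ultimately show "last w # butlast w \<in> Qtilde M k" using Q[of "butlast w"] w by simp
    qed
    show "(\<lambda>\<pi>. tl \<pi> @ [hd \<pi>]) ` Qtilde M k \<subseteq> min_last_words M k"
    proof (rule image_subsetI)
      fix \<pi> assume p: "\<pi> \<in> Qtilde M k"
      then have "\<pi> = Min M # tl \<pi>" "hd \<pi> = Min M" by (cases \<pi>; simp add: Qtilde_def)+
      then show "tl \<pi> @ [hd \<pi>] \<in> min_last_words M k" using Q[of "tl \<pi>"] p by simp
    qed
  qed
qed

lemma tree_word_bij:
  assumes "k \<ge> 1" "finite M" "M \<noteq> {}"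
  shows "bij_betw (tree_word k) (increasing_pruned_trees M k) (min_last_words M k)"
  unfolding increasing_pruned_trees_eq bij_betw_def
proof (intro conjI subset_antisym)
  let ?T = "{T. label T \<noteq> None \<and> valid k T \<and> distinct (labels T) \<and> set (labels T) = M}"
  show "inj_on (tree_word k) ?T"
  proof (rule inj_onI)
    fix S T assume "S \<in> ?T" "T \<in> ?T" "tree_word k S = tree_word k T"
    \<comment> \<open>\<open>tree_word_inj\<close> concerns unlabeled roots; an additional unlabeled
      parent leaves the word unchanged.\<close>
    then have "Node None [S] = Node None [T]"
      using assms(1) by (intro tree_word_inj[of k]) auto
    then show "S = T" by simp
  qed
  show "tree_word k ` ?T \<subseteq> min_last_words M k"
  proof (rule image_subsetI)
    fix T assume T: "T \<in> ?T"
    then obtain m ts where m: "T = Node (Some m) ts" by (cases T) auto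
    have "last (tree_word k T) = m" using tree_word_root T m assms(1) by auto
    moreover have "Min M = m"
      using T m labels_ge_root[of k m ts] assms(2) by (intro Min_eqI) auto
    moreover have "count (mset (tree_word k T)) a = k" if "a \<in> set (tree_word k T)" for a
    proof -
      have "a \<in> set (labels T)" using that T set_tree_word[of k T] assms(1) by auto
      then have "count (mset (labels T)) a = 1" using T distinct_count_atmost_1[of "labels T"] by auto
      then show ?thesis using count_tree_word[of k T a] T by simp
    qed
    ultimately show "tree_word k T \<in> min_last_words M k"
      using T stirling_tree_word[of k T] set_tree_word[of k T] assms(1)
      by (simp add: min_last_words_def)
  qed
  show "min_last_words M k \<subseteq> tree_word k ` ?T"
  proof
    fix w assume "w \<in> min_last_words M k"
    then have w: "stirling w" "set w = M" "\<forall>a\<in>set w. count (mset w) a = k" "last w = Min M"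
      by (auto simp: min_last_words_def)
    obtain t where t: "label t = None" "valid k t" "tree_word k t = w"
      using tree_word_surj[OF assms(1) w(1,3)] by blast
    have "\<not> is_leaf t" using tree_word_Nil_iff[OF t(2,1) assms(1)] t(3) w(2) assms(3) by auto
    then obtain T ss where ts: "t = Node None (T # ss)" using t(1)
      by (cases t) (auto simp: is_leaf_def neq_Nil_conv)
    obtain m us where m: "T = Node (Some m) us" "valid k (Node (Some m) us)" "valid k (Node None ss)"
      "\<And>b. b \<in> set (labels (Node None ss)) \<Longrightarrow> m < b"
      using valid_forest_Cons t(2) ts by metis
    have labs: "set (labels t) = M" using set_tree_word[OF t(2) assms(1)] t(3) w(2) by simp
    have wt: "w = tree_word k T @ tree_word k (Node None ss)" using t(3) ts by simp
    \<comment> \<open>Otherwise \<open>Min M\<close> would lie in the remainder, all of whose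
      letters exceed \<open>m \<in> M\<close>.\<close>
    have "tree_word k (Node None ss) = []"
    proof (rule ccontr)
      assume ne: "tree_word k (Node None ss) \<noteq> []"
      then have "Min M \<in> set (tree_word k (Node None ss))" using w(4) wt by (metis last_appendR last_in_set)
      then have "m < Min M" using m(4) set_tree_word[OF m(3) assms(1)] by blast
      moreover have "m \<in> M" using labs ts m(1) by auto
      ultimately show False using assms(2) by (meson Min_le leD)
    qed
    then have "ss = []" using tree_word_Nil_iff[OF m(3) _ assms(1)] by (simp add: is_leaf_def)
    then have T: "tree_word k T = w" "labels t = labels T" using wt ts by auto
    \<comment> \<open>Every letter occurs \<open>k\<close> times in \<open>w\<close> and
      \<open>k\<close> times for each of its occurrences among the labels; cancel
      \<open>k \<ge> 1\<close>.\<close>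
    have "distinct (labels T)"
      unfolding distinct_count_atmost_1
    proof
      fix a
      have "k * count (mset (labels T)) a = (if a \<in> set (labels T) then k else 0)"
        using count_tree_word[OF t(2), of a] t(3) T w(2,3) labs count_mset_0_iff[of w a] by auto
      then show "count (mset (labels T)) a = (if a \<in> set (labels T) then 1 else 0)"
        using assms(1) by (auto split: if_splits)
    qed
    then have "T \<in> ?T" using m(1,2) labs T(2) by simp
    then show "w \<in> tree_word k ` ?T" using T(1) by blast
  qed
qed

text \<open>Labels are injective on even-level nodes, and leaves on odd levels carry no
  label.\<close>

lemma lleaf_eq_card_leaf_labels:
  assumes "T \<in> increasing_pruned_trees M k"
  shows "lleaf T = card (leaf_labels T)"
proof -
  have bij: "bij_betw (label_at T) (even_nodes T) (Some ` M)"
    and odd: "\<And>p. p \<in> nodes T \<Longrightarrow> odd (length p) \<Longrightarrow> label_at T p = None"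
    using assms by (auto simp: increasing_pruned_trees_def)
  let ?L = "{p \<in> even_nodes T. is_leaf (subtree_at T p)}"
  have "label_at T ` ?L = Some ` leaf_labels T"
  proof (intro subset_antisym image_subsetI)
    fix p assume p: "p \<in> ?L"
    then obtain a where "label_at T p = Some a" using bij_betwE[OF bij] by auto
    moreover from this have "subtree_at T p = Node (Some a) []"
      using p by (cases "subtree_at T p") (auto simp: label_at_def is_leaf_def)
    ultimately show "label_at T p \<in> Some ` leaf_labels T"
      using p by (auto simp: leaf_labels_def even_nodes_def)
  next
    fix a assume "a \<in> leaf_labels T"
    then obtain p where p: "p \<in> nodes T" "subtree_at T p = Node (Some a) []"
      by (auto simp: leaf_labels_def)
    then have lab: "label_at T p = Some a" by (simp add: label_at_def)
    then have "even (length p)" using odd[OF p(1)] by auto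
    then have "p \<in> ?L" using p by (simp add: even_nodes_def is_leaf_def)
    then show "Some a \<in> label_at T ` ?L" using lab by force
  qed
  moreover have "inj_on (label_at T) ?L"
    using bij by (auto simp: bij_betw_def intro: inj_on_subset)
  ultimately show ?thesis unfolding lleaf_def by (metis card_image inj_Some)
qed

theorem proposition3p2:
  fixes k n :: nat and M :: "nat set"
  assumes "k \<ge> 1"
    and "finite M" and "card M = n" and "n \<ge> 2"
    and "\<forall>m \<in> M. m > 0"
  shows "\<exists>\<chi> :: nat list \<Rightarrow> nat option ptree.
           bij_betw \<chi> (Qtilde M k) (increasing_pruned_trees M k)
         \<and> (\<forall>\<pi> \<in> Qtilde M k. ap k \<pi> = lleaf (\<chi> \<pi>))
         \<and> (\<forall>\<pi> \<in> Qtilde M k.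
               (\<forall>i < k. \<pi> ! i = \<pi> ! 0) \<longleftrightarrow>
               (\<forall>t \<in> set (take (k - 1) (children (\<chi> \<pi>))). is_leaf t))"
proof -
  \<comment> \<open>The inverse of the required map, so both claims are checked starting from a
    tree.\<close>
  let ?\<psi> = "(\<lambda>w. last w # butlast w) \<circ> tree_word k"
  have "M \<noteq> {}" using assms(3,4) by auto
  then have bij: "bij_betw ?\<psi> (increasing_pruned_trees M k) (Qtilde M k)"
    using tree_word_bij rotate_bij assms(1,2) by (blast intro: bij_betw_trans)
  have stats: "ap k (?\<psi> T) = lleaf T \<and>
      ((\<forall>i < k. ?\<psi> T ! i = ?\<psi> T ! 0) \<longleftrightarrow> (\<forall>t \<in> set (take (k - 1) (children T)). is_leaf t))"
    if T: "T \<in> increasing_pruned_trees M k" for T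
  proof -
    have T': "label T \<noteq> None" "valid k T" "distinct (labels T)" "set (labels T) = M"
      using T by (auto simp: increasing_pruned_trees_eq)
    then obtain m ts where m: "T = Node (Some m) ts" by (cases T) auto
    \<comment> \<open>A single node would be a labeled leaf although its constant word has no
      ascent; \<open>n \<ge> 2\<close> excludes it.\<close>
    have "ts \<noteq> []"
    proof
      assume "ts = []"
      then have "M = {m}" using T'(4) m by simp
      then show False using assms(3,4) by simp
    qed
    then have len: "length ts = k" using T'(2) m by simp
    have child: "label t = None" "valid k t" "m \<notin> set (labels t)" "m \<notin> set (tree_word k t)"
      if "t \<in> set ts" for t
      using T'(2) m that set_tree_word[of k t] assms(1) by auto
    define Ws where "Ws = map (tree_word k) ts"
    have mfree: "\<forall>W\<in>set Ws. m \<notin> set W" using child(4) by (auto simp: Ws_def)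
    have "m # terminate_by m Vs = concat (map ((#) m) Vs) @ [m]" for Vs
      by (induction Vs) auto
    moreover have word: "tree_word k T = terminate_by m Ws"
      using m \<open>ts \<noteq> []\<close> by (simp add: Ws_def comp_def)
    moreover have root: "tree_word k T \<noteq> []" "last (tree_word k T) = m"
      using tree_word_root T'(2) m assms(1) by auto
    ultimately have pi: "?\<psi> T = concat (map ((#) m) Ws)"
      by (metis butlast.simps(2) butlast_snoc comp_apply)
    \<comment> \<open>Appending \<open>m\<close> produces the form needed for
      \<open>plateau_letter_tree_word\<close> with \<open>c = m\<close>, without affecting other
      letters.\<close>
    have pi': "?\<psi> T @ [m] = m # tree_word k T"
      using root by simp (metis append_butlast_last_id)
    have Qt: "?\<psi> T \<in> Qtilde M k" using bij_betwE[OF bij] T by blast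
    then have Q: "set (?\<psi> T) = M" "\<forall>a\<in>set (?\<psi> T). count (mset (?\<psi> T)) a = k"
      by (auto simp: Qtilde_def stirling_permutation_of_def mset_eq_multiset_pow_iff[OF assms(1,2)])
    have "plateau_letter k (?\<psi> T) a \<longleftrightarrow> a \<in> leaf_labels T" for a
    proof (cases "a \<in> M \<and> a \<noteq> m")
      case True
      obtain v where v: "?\<psi> T = m # v" using root by simp
      have "plateau_letter k (m # v) a \<longleftrightarrow> plateau_letter k ([m] @ v @ [m]) a"
        using plateau_letter_infix[of "[m]" a v "[m]" k] True Q(1) v by auto
      also have "[m] @ v @ [m] = m # tree_word k T" using pi' v by simp
      also have "plateau_letter k (m # tree_word k T) a \<longleftrightarrow> a \<in> leaf_labels T"
      proof (rule plateau_letter_tree_word[OF assms(1) T'(2,3)])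
        show "m \<le> b" if "b \<in> set (labels T)" for b using that labels_ge_root T'(2) m by blast
      qed (use True T'(4) in auto)
      finally show ?thesis using v by simp
    next
      case False
      moreover have "m \<notin> leaf_labels T"
        using \<open>ts \<noteq> []\<close> child(3) leaf_labels_subset by (simp add: m leaf_labels_Node) blast
      \<comment> \<open>The rotated word begins with \<open>m\<close>, so no letter precedes its
        first copy.\<close>
      moreover have "\<not> plateau_letter k (?\<psi> T) m" using root by (simp add: plateau_letter_def)
      ultimately show ?thesis
        using leaf_labels_subset[of T] T'(4) Q(1) unfolding plateau_letter_def by blast
    qed
    then have "ap k (?\<psi> T) = lleaf T"
      using ap_eq_card_plateau_letters[OF assms(1) Q(2)] lleaf_eq_card_leaf_labels[OF T] by simp
    \<comment> \<open>In \<open>m W\<^sub>1 m W\<^sub>2 \<dots> m W\<^sub>k\<close> the first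
      \<open>k\<close> letters agree exactly if all blocks but the last are empty.\<close>
    moreover have "(\<forall>i < k. ?\<psi> T ! i = ?\<psi> T ! 0) \<longleftrightarrow> (\<forall>t \<in> set (take (k - 1) ts). is_leaf t)"
    proof -
      have longer: "length Vs \<le> length (concat (map ((#) m) Vs))" for Vs by (induction Vs) auto
      have long: "k \<le> length (?\<psi> T)" unfolding pi using longer[of Ws] len by (simp add: Ws_def)
      have head: "?\<psi> T ! 0 = m" using root by simp
      have const: "(\<forall>i < k. p ! i = b) \<longleftrightarrow> take k p = replicate k b"
        if "k \<le> length p" for p and b :: nat
        using that by (auto simp: list_eq_iff_nth_eq)
      have "(\<forall>i < k. ?\<psi> T ! i = ?\<psi> T ! 0) \<longleftrightarrow> take k (?\<psi> T) = replicate k m"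
        unfolding head by (rule const[OF long])
      also have "\<dots> \<longleftrightarrow> (\<forall>W\<in>set (butlast Ws). W = [])"
        unfolding pi using take_concat_Cons[OF _ mfree] len \<open>ts \<noteq> []\<close> by (simp add: Ws_def)
      also have "butlast Ws = map (tree_word k) (take (k - 1) ts)"
        using len by (simp add: Ws_def butlast_conv_take take_map)
      also have "(\<forall>W\<in>set (map (tree_word k) (take (k - 1) ts)). W = []) \<longleftrightarrow>
          (\<forall>t \<in> set (take (k - 1) ts). is_leaf t)"
      proof -
        have "tree_word k t = [] \<longleftrightarrow> is_leaf t" if "t \<in> set (take (k - 1) ts)" for t
          using tree_word_Nil_iff child(1,2)[OF in_set_takeD[OF that]] assms(1) by blast
        then show ?thesis by simp
      qed
      finally show ?thesis .
    qed
    moreover have "children T = ts" using m by simp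
    ultimately show ?thesis by (simp only: simp_thms)
  qed
  define \<chi> where "\<chi> = inv_into (increasing_pruned_trees M k) ?\<psi>"
  have chi: "bij_betw \<chi> (Qtilde M k) (increasing_pruned_trees M k)"
    unfolding \<chi>_def by (rule bij_betw_inv_into[OF bij])
  have "ap k \<pi> = lleaf (\<chi> \<pi>) \<and>
      ((\<forall>i < k. \<pi> ! i = \<pi> ! 0) \<longleftrightarrow> (\<forall>t \<in> set (take (k - 1) (children (\<chi> \<pi>))). is_leaf t))"
    if p: "\<pi> \<in> Qtilde M k" for \<pi>
  proof -
    have "?\<psi> (\<chi> \<pi>) = \<pi>" unfolding \<chi>_def by (rule bij_betw_inv_into_right[OF bij p])
    moreover have "\<chi> \<pi> \<in> increasing_pruned_trees M k" using bij_betwE[OF chi] p by blast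
    ultimately show ?thesis using stats[of "\<chi> \<pi>"] by (simp only:)
  qed
  with chi show ?thesis by blast
qed

end
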